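(* Let $k\ge2$, $m=2k-1$, and $1\le a,b\le m$, and consider the word $P=MMMMVV$. Let $\operatorname{FullCompat}(k;a,b)$ mean that there is at least one state in $F(MMMMVV,k)$ whose restriction to the upper faces is $A(W_a)$ and whose restriction to the lower faces is $B(W_b)$. Then $$\operatorname{FullCompat}(k;a,b)\iff (a=1)\ \text{or}\ (a=m)\ \text{or}\ (a=b).$$ Every such compatible ordered pair $(a,b)$ determines exactly one state of $F(MMMMVV,k)$ with these row restrictions. Conversely, every state in $F(MMMMVV,k)$ determines a unique ordered pair $(a,b)\in\{1,\dots,m\}^2$ such that its upper and lower row restrictions are $A(W_a)$ and $B(W_b)$.
   Context: Map and assignment. Let $k\ge2$, $n=2k$. The upper faces are $A_1,\dots,A_n$, the lower faces $B_1,\dots,B_n$. The creases are $H_c=(A_c,B_c)$ ($1\le c\le n$), $U_i=(A_i,A_{i+1})$ and $L_i=(B_i,B_{i+1})$ ($1\le i\le n-1$); the two faces of a crease are its wings. A word $P=(h_0,h_1,u_0,u_1,l_0,l_1)\in\{M,V\}^6$ (written as a six-letter string) assigns to $H_c$ the label $h_{(c-1)\bmod 2}$ and to $U_i,L_i$ the labels $u_{(i-1)\bmod2},l_{(i-1)\bmod2}$. The assignment is locally flat-foldable if for every $1\le c\le n-1$ an odd number of the four creases $H_c,H_{c+1},U_c,L_c$ (meeting at an interior vertex) are labelled $M$. States. $x\prec y$ means $x$ lies above (comes before) $y$ in a total order. A strict total order of all $4k$ labelled faces is order-valid for $P$ if: (i) Precedence: with $A_c$ in row $r=0$ and $B_c$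 in row $r=1$, the face in row $r$, column $c$ is light-up iff $r+c-1$ is even and dark-up otherwise; across each $M$ crease the light-up wing precedes the dark-up wing, across each $V$ crease the dark-up wing precedes the light-up wing. (ii) Noncrossing: every $H_c$ has target class $S$; $U_i$ and $L_i$ have class $E$ for $i$ odd and $W$ for $i$ even; for any two distinct creases of the same target class with disjoint wing sets, with wing positions $a_0<a_1$ and $b_0<b_1$ in the order, neither $a_0<b_0<a_1<b_1$ nor $b_0<a_0<b_1<a_1$. $F(P,k)$ is the set of all order-valid strict total orders if $P$ is locally flat-foldable, and $F(P,k)=\varnothing$ otherwise. Row words. Write $O_i=2i-1$, $D_i=2i$ for $1\le i\le k$. For $1\le p\le 2k-1$ define the column word $W_p$ by $W_{2s-1}=(O_s,O_{s-1},\dots,O_1,D_1,\dots,D_{s-1},O_{s+1},\dots,O_k,D_k,\dots,D_{s+1},D_s)$ and $W_{2s}=(O_{s+1},\dots,O_k,D_k,\dots,D_{s+1},O_s,\dots,O_1,D_1,\dots,D_s)$, empty blocks omitted. If $W_p=(c_1,\dots,c_n)$, then $A(W_p)$ is the order $A_{c_1}\prec\cdots\prec A_{c_n}$ and $B(W_p)$ the order $B_{c_1}\prec\cdots\prec B_{c_n}$. The index $p$ is called the pivot. *)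

theory Defs
  imports Main
begin

datatype face = A nat | B nat

datatype crease = H nat | U nat | L nat

datatype label = M | V

datatype target = South | East | West

text \<open>Faces and creases carry one-based column indices. Hence in a map with \<open>2 * k\<close> columns every
  index \<open>c\<close> satisfies \<open>c \<ge> 1\<close>, and the natural-number subtractions \<open>c - 1\<close> below do not truncate.\<close>

definition upper_faces :: "nat \<Rightarrow> face set" where
  "upper_faces k = A ` {1..2 * k}"

definition lower_faces :: "nat \<Rightarrow> face set" where
  "lower_faces k = B ` {1..2 * k}"

definition faces :: "nat \<Rightarrow> face set" where
  "faces k = upper_faces k \<union> lower_faces k"

definition creases :: "nat \<Rightarrow> crease set" where
  "creases k = H ` {1..2 * k} \<union> U ` {1..2 * k - 1} \<union> L ` {1..2 * k - 1}"

fun wings :: "crease \<Rightarrow> face set" where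
  "wings (H c) = {A c, B c}"
| "wings (U i) = {A i, A (i + 1)}"
| "wings (L i) = {B i, B (i + 1)}"

text \<open>A word lists its letters in the order \<open>(h\<^sub>0, h\<^sub>1, u\<^sub>0, u\<^sub>1, l\<^sub>0, l\<^sub>1)\<close>.\<close>

type_synonym word = "label \<times> label \<times> label \<times> label \<times> label \<times> label"

fun crease_label :: "word \<Rightarrow> crease \<Rightarrow> label" where
  "crease_label (h0, h1, u0, u1, l0, l1) (H c) = (if (c - 1) mod 2 = 0 then h0 else h1)"
| "crease_label (h0, h1, u0, u1, l0, l1) (U i) = (if (i - 1) mod 2 = 0 then u0 else u1)"
| "crease_label (h0, h1, u0, u1, l0, l1) (L i) = (if (i - 1) mod 2 = 0 then l0 else l1)"

definition locally_flat_foldable :: "word \<Rightarrow> nat \<Rightarrow> bool" where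
  "locally_flat_foldable P k \<longleftrightarrow>
     (\<forall>c \<in> {1..2 * k - 1}. odd (card {e \<in> {H c, H (c + 1), U c, L c}. crease_label P e = M}))"

fun row :: "face \<Rightarrow> nat" where
  "row (A c) = 0"
| "row (B c) = 1"

fun column :: "face \<Rightarrow> nat" where
  "column (A c) = c"
| "column (B c) = c"

definition light_up :: "face \<Rightarrow> bool" where
  "light_up f \<longleftrightarrow> even (row f + column f - 1)"

abbreviation dark_up :: "face \<Rightarrow> bool" where
  "dark_up f \<equiv> \<not> light_up f"

fun target_class :: "crease \<Rightarrow> target" where
  "target_class (H c) = South"
| "target_class (U i) = (if odd i then East else West)"
| "target_class (L i) = (if odd i then East else West)"

text \<open>In all relations below, \<open>(x, y) \<in> r\<close> means that \<open>x\<close> lies above (comes before) \<open>y\<close>.\<close>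

definition precedence :: "word \<Rightarrow> nat \<Rightarrow> face rel \<Rightarrow> bool" where
  "precedence P k r \<longleftrightarrow>
     (\<forall>e \<in> creases k. \<forall>x \<in> wings e. \<forall>y \<in> wings e. light_up x \<and> dark_up y \<longrightarrow>
        (case crease_label P e of M \<Rightarrow> (x, y) \<in> r | V \<Rightarrow> (y, x) \<in> r))"

definition noncrossing :: "nat \<Rightarrow> face rel \<Rightarrow> bool" where
  "noncrossing k r \<longleftrightarrow>
     (\<forall>e \<in> creases k. \<forall>f \<in> creases k.
        e \<noteq> f \<and> target_class e = target_class f \<and> wings e \<inter> wings f = {} \<longrightarrow>
        (\<forall>a0 a1 b0 b1.
           wings e = {a0, a1} \<and> (a0, a1) \<in> r \<and> wings f = {b0, b1} \<and> (b0, b1) \<in> r \<longrightarrow>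
           \<not> ((a0, b0) \<in> r \<and> (b0, a1) \<in> r \<and> (a1, b1) \<in> r) \<and>
           \<not> ((b0, a0) \<in> r \<and> (a0, b1) \<in> r \<and> (b1, a1) \<in> r)))"

text \<open>The library predicate \<^const>\<open>strict_linear_order_on\<close> does not bound the field of the relation;
  the inclusion makes \<open>r\<close> a relation on the given faces only, so that distinct elements are
  distinct orders.\<close>

definition order_valid :: "word \<Rightarrow> nat \<Rightarrow> face rel \<Rightarrow> bool" where
  "order_valid P k r \<longleftrightarrow>
     r \<subseteq> faces k \<times> faces k \<and> strict_linear_order_on (faces k) r \<and>
     precedence P k r \<and> noncrossing k r"

definition F :: "word \<Rightarrow> nat \<Rightarrow> face rel set" where
  "F P k = (if locally_flat_foldable P k then {r. order_valid P k r} else {})"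

definition O_col :: "nat \<Rightarrow> nat" where
  "O_col i = 2 * i - 1"

definition D_col :: "nat \<Rightarrow> nat" where
  "D_col i = 2 * i"

text \<open>With \<open>s = (p + 1) div 2\<close>, the pivot \<open>p\<close> is \<open>2 * s - 1\<close> if odd and \<open>2 * s\<close> if even.\<close>

definition column_word :: "nat \<Rightarrow> nat \<Rightarrow> nat list" where
  "column_word k p =
     (let s = (p + 1) div 2 in
      if odd p then
        map O_col (rev [1..<s + 1]) @ map D_col [1..<s] @
        map O_col [s + 1..<k + 1] @ map D_col (rev [s..<k + 1])
      else
        map O_col [s + 1..<k + 1] @ map D_col (rev [s + 1..<k + 1]) @
        map O_col (rev [1..<s + 1]) @ map D_col [1..<s + 1])"

definition order_of_list :: "'a list \<Rightarrow> 'a rel" where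
  "order_of_list xs = {(xs ! i, xs ! j) | i j. i < j \<and> j < length xs}"

definition upper_order :: "nat \<Rightarrow> nat \<Rightarrow> face rel" where
  "upper_order k p = order_of_list (map A (column_word k p))"

definition lower_order :: "nat \<Rightarrow> nat \<Rightarrow> face rel" where
  "lower_order k p = order_of_list (map B (column_word k p))"

definition has_row_orders :: "nat \<Rightarrow> face rel \<Rightarrow> nat \<Rightarrow> nat \<Rightarrow> bool" where
  "has_row_orders k r a b \<longleftrightarrow>
     Restr r (upper_faces k) = upper_order k a \<and> Restr r (lower_faces k) = lower_order k b"

definition MMMMVV :: word where
  "MMMMVV = (M, M, M, M, V, V)"

definition FullCompat :: "nat \<Rightarrow> nat \<Rightarrow> nat \<Rightarrow> bool" where
  "FullCompat k a b \<longleftrightarrow> (\<exists>r \<in> F MMMMVV k. has_row_orders k r a b)"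

end

theory Submission
  imports Defs
begin

text \<open>For the word \<open>MMMMVV\<close> odd columns lie above adjacent even columns within each row, with
  \<open>A\<^sub>x \<prec> B\<^sub>x\<close> for odd \<open>x\<close> and \<open>B\<^sub>y \<prec> A\<^sub>y\<close> for even \<open>y\<close>. An order is encoded by an integer key on the
  faces, so that validity becomes a system of linear inequalities.

  A single row winds in one rotational sense, hence it is a spiral that expands up to some column
  \<open>p\<close> and contracts from there on; this is \<open>W\<^sub>p\<close>. Given both rows, the noncrossing hinges leave only
  one kind of pair of columns undecided, an odd \<open>x\<close> and an even \<open>y\<close> with \<open>x\<close> before \<open>y\<close> in the upper
  and \<open>y\<close> before \<open>x\<close> in the lower row, and noncrossing of the arcs \<open>U\<^sub>x\<close> and \<open>L\<^sub>y\<^sub>-\<^sub>1\<close> decides it. So the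
  rows determine the state. Moreover, an even column preceding an odd one in the upper row does so in
  the lower row, which forces \<open>a = 1\<close>, \<open>a = m\<close> or \<open>a = b\<close>.\<close>

section \<open>Orders given by integer keys\<close>

text \<open>A state is a set of pairs, so equality of states amounts to agreement of comparisons
  between keys. The restriction to \<open>faces k\<close> discards the values of the key
  elsewhere.\<close>

definition order_by :: "nat \<Rightarrow> (face \<Rightarrow> int) \<Rightarrow> face rel" where
  "order_by k f = {(x, y). x \<in> faces k \<and> y \<in> faces k \<and> f x < f y}"

text \<open>Upper and lower refer to the position in the stack, not to the row. The labels of
  \<open>MMMMVV\<close> and the chequered orientation put the odd column first on every arc,
  \<open>A c\<close> first on odd hinges and \<open>B c\<close> first on even ones.\<close>

fun upper_wing :: "crease \<Rightarrow> face" where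
  "upper_wing (H c) = (if odd c then A c else B c)"
| "upper_wing (U i) = (if odd i then A i else A (i + 1))"
| "upper_wing (L i) = (if odd i then B i else B (i + 1))"

fun lower_wing :: "crease \<Rightarrow> face" where
  "lower_wing (H c) = (if odd c then B c else A c)"
| "lower_wing (U i) = (if odd i then A (i + 1) else A i)"
| "lower_wing (L i) = (if odd i then B (i + 1) else B i)"

text \<open>Only one crossing pattern is listed, since the quantification over ordered pairs of
  creases supplies the other by exchange.\<close>

definition valid_key :: "nat \<Rightarrow> (face \<Rightarrow> int) \<Rightarrow> bool" where
  "valid_key k f \<longleftrightarrow> inj_on f (faces k) \<and>
     (\<forall>e \<in> creases k. f (upper_wing e) < f (lower_wing e)) \<and>
     (\<forall>e \<in> creases k. \<forall>e' \<in> creases k.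
        e \<noteq> e' \<and> target_class e = target_class e' \<and> wings e \<inter> wings e' = {} \<longrightarrow>
        \<not> (f (upper_wing e) < f (upper_wing e') \<and> f (upper_wing e') < f (lower_wing e) \<and>
           f (lower_wing e) < f (lower_wing e')))"

lemma A_in_faces [simp]: "A c \<in> faces k \<longleftrightarrow> c \<in> {1..2 * k}"
  and B_in_faces [simp]: "B c \<in> faces k \<longleftrightarrow> c \<in> {1..2 * k}"
  by (auto simp: faces_def upper_faces_def lower_faces_def)

lemma finite_faces [simp]: "finite (faces k)"
  by (simp add: faces_def upper_faces_def lower_faces_def)

lemma crease_in_creases [simp]:
  "H c \<in> creases k \<longleftrightarrow> c \<in> {1..2 * k}"
  "U i \<in> creases k \<longleftrightarrow> i \<in> {1..2 * k - 1}"
  "L i \<in> creases k \<longleftrightarrow> i \<in> {1..2 * k - 1}"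
  by (auto simp: creases_def)

lemma wings_eq: "wings e = {upper_wing e, lower_wing e}"
  by (cases e) auto

lemma wings_subset_faces:
  assumes "e \<in> creases k"
  shows "upper_wing e \<in> faces k" "lower_wing e \<in> faces k"
  using assms by (cases e; auto)+

lemma precedence_MMMMVV:
  "precedence MMMMVV k r \<longleftrightarrow> (\<forall>e \<in> creases k. (upper_wing e, lower_wing e) \<in> r)"
proof -
  have "(\<forall>x \<in> wings e. \<forall>y \<in> wings e. light_up x \<and> dark_up y \<longrightarrow>
        (case crease_label MMMMVV e of M \<Rightarrow> (x, y) \<in> r | V \<Rightarrow> (y, x) \<in> r))
      \<longleftrightarrow> (upper_wing e, lower_wing e) \<in> r" if "e \<in> creases k" for e
    using that by (cases e) (auto simp: MMMMVV_def light_up_def)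
  then show ?thesis
    by (auto simp: precedence_def)
qed

lemma order_by_key:
  assumes "strict_linear_order_on (faces k) r" and "r \<subseteq> faces k \<times> faces k"
  obtains f where "inj_on f (faces k)" and "r = order_by k f"
proof -
  \<comment> \<open>The number of predecessors is the rank of a face.\<close>
  define f where "f = (\<lambda>x. int (card {y. (y, x) \<in> r}))"
  have fin: "finite {y. (y, x) \<in> r}" for x
    by (rule finite_subset[OF _ finite_faces[of k]]) (use assms in auto)
  have r: "trans r" "irrefl r" "total_on (faces k) r"
    using assms by (auto simp: strict_linear_order_on_def)
  have less: "f x < f y" if "(x, y) \<in> r" for x y
  proof -
    have "{z. (z, x) \<in> r} \<subset> {z. (z, y) \<in> r}"
      using r(1,2) that by (auto simp: irrefl_def dest: transD)
    then show ?thesis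
      unfolding f_def using psubset_card_mono[OF fin] by auto
  qed
  have iff: "(x, y) \<in> r \<longleftrightarrow> f x < f y" if "x \<in> faces k" "y \<in> faces k" for x y
  proof -
    have "x = y \<or> (x, y) \<in> r \<or> (y, x) \<in> r"
      using r(3) that by (auto simp: total_on_def)
    then show ?thesis
      using less[of x y] less[of y x] by auto
  qed
  show ?thesis
  proof
    show "inj_on f (faces k)"
      using r(3) less by (fastforce simp: inj_on_def total_on_def)
    show "r = order_by k f"
      using iff assms(2) by (auto simp: order_by_def)
  qed
qed

lemma order_valid_order_by:
  assumes "inj_on f (faces k)"
  shows "order_valid MMMMVV k (order_by k f) \<longleftrightarrow> valid_key k f"
proof -
  have lin: "strict_linear_order_on (faces k) (order_by k f)"
    using assms unfolding strict_linear_order_on_def order_by_def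
    by (auto simp: trans_def irrefl_def total_on_def inj_on_def) (metis linorder_neqE)
  have sub: "order_by k f \<subseteq> faces k \<times> faces k"
    by (auto simp: order_by_def)
  have prec: "precedence MMMMVV k (order_by k f) \<longleftrightarrow>
      (\<forall>e \<in> creases k. f (upper_wing e) < f (lower_wing e))"
    by (auto simp: precedence_MMMMVV order_by_def wings_subset_faces)
  \<comment> \<open>The directions \<open>dir\<close> enter because they identify the earlier wing
    of a crease with \<open>upper_wing\<close>.\<close>
  have nc: "noncrossing k (order_by k f) \<longleftrightarrow>
      (\<forall>e \<in> creases k. \<forall>e' \<in> creases k.
        e \<noteq> e' \<and> target_class e = target_class e' \<and> wings e \<inter> wings e' = {} \<longrightarrow>
        \<not> (f (upper_wing e) < f (upper_wing e') \<and> f (upper_wing e') < f (lower_wing e) \<and>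
           f (lower_wing e) < f (lower_wing e')))" (is "_ \<longleftrightarrow> ?R")
    if dir: "\<forall>e \<in> creases k. f (upper_wing e) < f (lower_wing e)"
  proof
    assume *: "noncrossing k (order_by k f)"
    show ?R
    proof (intro ballI impI)
      fix e e' assume e: "e \<in> creases k" "e' \<in> creases k"
        "e \<noteq> e' \<and> target_class e = target_class e' \<and> wings e \<inter> wings e' = {}"
      show "\<not> (f (upper_wing e) < f (upper_wing e') \<and> f (upper_wing e') < f (lower_wing e) \<and>
           f (lower_wing e) < f (lower_wing e'))"
        using *[unfolded noncrossing_def, rule_format, OF e, of "upper_wing e" "lower_wing e"
            "upper_wing e'" "lower_wing e'"] dir e wings_eq wings_subset_faces
        by (auto simp: order_by_def)
    qed
  next
    assume *: ?R
    show "noncrossing k (order_by k f)"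
      unfolding noncrossing_def
    proof (intro ballI impI allI, elim conjE)
      fix e e' a0 a1 b0 b1
      assume e: "e \<in> creases k" "e' \<in> creases k" "e \<noteq> e'" "target_class e = target_class e'"
        "wings e \<inter> wings e' = {}" and a: "wings e = {a0, a1}" "(a0, a1) \<in> order_by k f"
        and b: "wings e' = {b0, b1}" "(b0, b1) \<in> order_by k f"
      have "a0 = upper_wing e" "a1 = lower_wing e"
        using dir e(1) a wings_eq[of e] by (auto simp: order_by_def doubleton_eq_iff)
      moreover have "b0 = upper_wing e'" "b1 = lower_wing e'"
        using dir e(2) b wings_eq[of e'] by (auto simp: order_by_def doubleton_eq_iff)
      ultimately show "\<not> ((a0, b0) \<in> order_by k f \<and> (b0, a1) \<in> order_by k f \<and> (a1, b1) \<in> order_by k f) \<and>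
           \<not> ((b0, a0) \<in> order_by k f \<and> (a0, b1) \<in> order_by k f \<and> (b1, a1) \<in> order_by k f)"
        using *[rule_format, of e e'] *[rule_format, of e' e] e by (auto simp: order_by_def)
    qed
  qed
  show ?thesis
    unfolding order_valid_def valid_key_def using lin sub prec nc assms by blast
qed

lemma locally_flat_foldable_MMMMVV: "locally_flat_foldable MMMMVV k"
proof -
  have "{e \<in> {H c, H (c + 1), U c, L c}. crease_label MMMMVV e = M} = {H c, H (c + 1), U c}" for c
    by (auto simp: MMMMVV_def)
  then show ?thesis
    unfolding locally_flat_foldable_def by simp
qed

lemma F_MMMMVV: "F MMMMVV k = order_by k ` Collect (valid_key k)"
proof -
  have "r \<in> order_by k ` Collect (valid_key k)" if "order_valid MMMMVV k r" for r
    using that order_by_key[of k r] order_valid_order_by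
    by (metis image_eqI mem_Collect_eq order_valid_def)
  moreover have "order_valid MMMMVV k (order_by k f)" if "valid_key k f" for f
    using that order_valid_order_by valid_key_def by blast
  ultimately show ?thesis
    by (auto simp: F_def locally_flat_foldable_MMMMVV)
qed

lemma valid_keyD:
  assumes "valid_key k f"
  shows "\<lbrakk>x \<in> {1..2 * k}; y \<in> {1..2 * k}; x \<noteq> y\<rbrakk> \<Longrightarrow> f (A x) \<noteq> f (A y)"
    and "\<lbrakk>x \<in> {1..2 * k}; y \<in> {1..2 * k}; x \<noteq> y\<rbrakk> \<Longrightarrow> f (B x) \<noteq> f (B y)"
    and "\<lbrakk>x \<in> {1..2 * k}; y \<in> {1..2 * k}\<rbrakk> \<Longrightarrow> f (A x) \<noteq> f (B y)"
    and "\<lbrakk>e \<in> creases k\<rbrakk> \<Longrightarrow> f (upper_wing e) < f (lower_wing e)"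
    and "\<lbrakk>e \<in> creases k; e' \<in> creases k; e \<noteq> e'; target_class e = target_class e';
        wings e \<inter> wings e' = {}\<rbrakk> \<Longrightarrow>
        \<not> (f (upper_wing e) < f (upper_wing e') \<and> f (upper_wing e') < f (lower_wing e) \<and>
           f (lower_wing e) < f (lower_wing e'))"
proof -
  have "inj_on f (faces k)"
    using assms by (simp add: valid_key_def)
  then show "\<lbrakk>x \<in> {1..2 * k}; y \<in> {1..2 * k}; x \<noteq> y\<rbrakk> \<Longrightarrow> f (A x) \<noteq> f (A y)"
    and "\<lbrakk>x \<in> {1..2 * k}; y \<in> {1..2 * k}; x \<noteq> y\<rbrakk> \<Longrightarrow> f (B x) \<noteq> f (B y)"
    and "\<lbrakk>x \<in> {1..2 * k}; y \<in> {1..2 * k}\<rbrakk> \<Longrightarrow> f (A x) \<noteq> f (B y)"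
    by (metis A_in_faces B_in_faces face.inject face.distinct inj_onD)+
qed (use assms in \<open>auto simp: valid_key_def\<close>)

section \<open>Column words\<close>

text \<open>The order \<open>W\<^sub>p\<close> consists of two spirals, on the columns up to \<open>p\<close> and on the columns beyond \<open>p\<close>;
  the parity of \<open>p\<close> decides which of the two comes first.\<close>

definition column_key :: "nat \<Rightarrow> nat \<Rightarrow> nat \<Rightarrow> int" where
  "column_key k p c =
     (if c \<le> p then (if odd c then - int c else int c)
      else (if odd p then 8 * int k else - 8 * int k) +
           (if odd c then int c - 4 * int k else 4 * int k - int c))"

text \<open>Sortedness identifies comparison of positions with comparison of values of
  \<open>h\<close>, which turns the row orders given by lists into inequalities.\<close>

lemma order_of_list_map:
  fixes h :: "'a \<Rightarrow> int"
  assumes "sorted_wrt (\<lambda>x y. h x < h y) xs"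
  shows "order_of_list (map g xs) = {(g x, g y) | x y. x \<in> set xs \<and> y \<in> set xs \<and> h x < h y}"
proof -
  have iff: "h (xs ! i) < h (xs ! j) \<longleftrightarrow> i < j" if "i < length xs" "j < length xs" for i j
    using sorted_wrt_nth_less[OF assms, of i j] sorted_wrt_nth_less[OF assms, of j i] that
    by (cases i j rule: linorder_cases) auto
  show ?thesis
  proof (intro equalityI subrelI)
    fix u v assume "(u, v) \<in> order_of_list (map g xs)"
    then obtain i j where "i < j" "j < length xs" "u = g (xs ! i)" "v = g (xs ! j)"
      by (auto simp: order_of_list_def)
    then show "(u, v) \<in> {(g x, g y) | x y. x \<in> set xs \<and> y \<in> set xs \<and> h x < h y}"
      using iff[of i j] nth_mem[of i xs] nth_mem[of j xs] order_less_trans[of i j] by blast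
  next
    fix u v assume "(u, v) \<in> {(g x, g y) | x y. x \<in> set xs \<and> y \<in> set xs \<and> h x < h y}"
    then obtain i j where "i < length xs" "j < length xs" "h (xs ! i) < h (xs ! j)"
      "u = g (xs ! i)" "v = g (xs ! j)"
      by (auto simp: in_set_conv_nth)
    then show "(u, v) \<in> order_of_list (map g xs)"
      using iff[of i j] unfolding order_of_list_def
      by (intro CollectI exI[of _ i] exI[of _ j]) simp
  qed
qed

lemma set_column_word:
  assumes "p \<in> {1..2 * k - 1}"
  shows "set (column_word k p) = {1..2 * k}"
proof -
  define s where "s = (p + 1) div 2"
  have s: "1 \<le> s" "s \<le> k"
    using assms by (auto simp: s_def)
  have eq: "{1..2 * k} = O_col ` {1..<k + 1} \<union> D_col ` {1..<k + 1}"
  proof (intro equalityI subsetI)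
    fix c assume c: "c \<in> {1..2 * k}"
    show "c \<in> O_col ` {1..<k + 1} \<union> D_col ` {1..<k + 1}"
    proof (cases "odd c")
      case True
      then have "c = O_col ((c + 1) div 2)" "(c + 1) div 2 \<in> {1..<k + 1}"
        using c by (auto simp: O_col_def elim!: oddE)
      then show ?thesis by blast
    next
      case False
      then have "c = D_col (c div 2)" "c div 2 \<in> {1..<k + 1}"
        using c by (auto simp: D_col_def elim!: evenE)
      then show ?thesis by blast
    qed
  qed (auto simp: O_col_def D_col_def)
  have un: "{1..<k + 1} = {1..<s + 1} \<union> {s + 1..<k + 1}" "{1..<k + 1} = {1..<s} \<union> {s..<k + 1}"
    using s by auto
  have O_split: "O_col ` {1..<k + 1} = O_col ` {1..<s + 1} \<union> O_col ` {s + 1..<k + 1}"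
    and D_split: "D_col ` {1..<k + 1} = D_col ` {1..<s + 1} \<union> D_col ` {s + 1..<k + 1}"
      "D_col ` {1..<k + 1} = D_col ` {1..<s} \<union> D_col ` {s..<k + 1}"
    using un by (metis image_Un)+
  show ?thesis
  proof (cases "odd p")
    case True
    then show ?thesis
      unfolding column_word_def Let_def s_def[symmetric] eq O_split D_split(2)
      by (simp only: if_True not_False_eq_True set_append set_map set_rev set_upt Un_ac)
  next
    case False
    then show ?thesis
      unfolding column_word_def Let_def s_def[symmetric] eq O_split D_split(1)
      by (simp only: if_False set_append set_map set_rev set_upt Un_ac)
  qed
qed

text \<open>On odd and on even columns \<open>column_key\<close> has a closed form in the block
  index. Each block is monotone in it, and the offset \<open>8 * int k\<close> keeps the two spirals
  apart.\<close>

lemma sorted_column_word: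
  assumes "p \<in> {1..2 * k - 1}"
  shows "sorted_wrt (\<lambda>x y. column_key k p x < column_key k p y) (column_word k p)"
proof -
  define s where "s = (p + 1) div 2"
  have s: "1 \<le> s" "s \<le> k"
    using assms by (auto simp: s_def)
  have asc: "sorted_wrt P [i..<j]" if "\<And>x y. \<lbrakk>i \<le> x; x < y; y < j\<rbrakk> \<Longrightarrow> P x y" for P i j
    using that by (auto simp: sorted_wrt_iff_nth_less)
  have desc: "sorted_wrt P (rev [i..<j])" if "\<And>x y. \<lbrakk>i \<le> x; x < y; y < j\<rbrakk> \<Longrightarrow> P y x" for P i j
    using that by (auto simp: sorted_wrt_rev intro: asc)
  show ?thesis
  proof (cases "odd p")
    case True
    then have p: "p = 2 * s - 1"
      by (auto simp: s_def)
    have O_key: "column_key k p (O_col i) =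
        (if i \<le> s then 1 - 2 * int i else 4 * int k + 2 * int i - 1)" if "1 \<le> i" for i
      using that s by (auto simp: column_key_def O_col_def p of_nat_diff)
    have D_key: "column_key k p (D_col i) =
        (if i < s then 2 * int i else 12 * int k - 2 * int i)" if "1 \<le> i" for i
      using that s by (auto simp: column_key_def D_col_def p of_nat_diff)
    show ?thesis
      unfolding column_word_def Let_def s_def[symmetric] using True s
      by (auto simp: sorted_wrt_append sorted_wrt_map O_key D_key intro!: asc desc)
  next
    case False
    then have p: "p = 2 * s"
      by (auto simp: s_def elim!: evenE)
    have O_key: "column_key k p (O_col i) =
        (if i \<le> s then 1 - 2 * int i else 2 * int i - 1 - 12 * int k)" if "1 \<le> i" for i
      using that s by (auto simp: column_key_def O_col_def p of_nat_diff)
    have D_key: "column_key k p (D_col i) =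
        (if i \<le> s then 2 * int i else - 4 * int k - 2 * int i)" if "1 \<le> i" for i
      using that s by (auto simp: column_key_def D_col_def p of_nat_diff)
    show ?thesis
      unfolding column_word_def Let_def s_def[symmetric] using False s
      by (auto simp: sorted_wrt_append sorted_wrt_map O_key D_key intro!: asc desc)
  qed
qed

lemma has_row_orders_order_by:
  assumes "a \<in> {1..2 * k - 1}" and "b \<in> {1..2 * k - 1}"
  shows "has_row_orders k (order_by k f) a b \<longleftrightarrow>
    (\<forall>x \<in> {1..2 * k}. \<forall>y \<in> {1..2 * k}.
      (f (A x) < f (A y) \<longleftrightarrow> column_key k a x < column_key k a y) \<and>
      (f (B x) < f (B y) \<longleftrightarrow> column_key k b x < column_key k b y))"
proof -
  have "upper_order k a = {(A x, A y) | x y. x \<in> {1..2 * k} \<and> y \<in> {1..2 * k} \<and>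
      column_key k a x < column_key k a y}"
    unfolding upper_order_def order_of_list_map[OF sorted_column_word[OF assms(1)]]
      set_column_word[OF assms(1)] ..
  moreover have "lower_order k b = {(B x, B y) | x y. x \<in> {1..2 * k} \<and> y \<in> {1..2 * k} \<and>
      column_key k b x < column_key k b y}"
    unfolding lower_order_def order_of_list_map[OF sorted_column_word[OF assms(2)]]
      set_column_word[OF assms(2)] ..
  moreover have "Restr (order_by k f) (upper_faces k) = {(A x, A y) | x y. x \<in> {1..2 * k} \<and>
      y \<in> {1..2 * k} \<and> f (A x) < f (A y)}"
    by (auto simp: order_by_def upper_faces_def)
  moreover have "Restr (order_by k f) (lower_faces k) = {(B x, B y) | x y. x \<in> {1..2 * k} \<and>
      y \<in> {1..2 * k} \<and> f (B x) < f (B y)}"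
    by (auto simp: order_by_def lower_faces_def)
  moreover have "{(g x, g y) | x y. R x y} = {(g x, g y) | x y. S x y} \<longleftrightarrow>
      (\<forall>x y. R x y = S x y)" if "inj g" for g :: "nat \<Rightarrow> face" and R S
  proof
    assume eq: "{(g x, g y) | x y. R x y} = {(g x, g y) | x y. S x y}"
    have "R x y \<longleftrightarrow> (g x, g y) \<in> {(g x, g y) | x y. R x y}"
      "S x y \<longleftrightarrow> (g x, g y) \<in> {(g x, g y) | x y. S x y}" for x y
      using that by (auto dest: injD)
    then show "\<forall>x y. R x y = S x y"
      unfolding eq by blast
  qed simp
  moreover have "inj A" "inj B"
    by (auto simp: inj_def)
  ultimately show ?thesis
    unfolding has_row_orders_def by (simp only:) blast
qed

lemma column_key_inj:
  assumes "x \<in> {1..2 * k}" "y \<in> {1..2 * k}" "column_key k p x = column_key k p y"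
  shows "x = y"
  using assms by (auto simp: column_key_def split: if_splits)

text \<open>The columns \<open>p\<close> and \<open>p + 1\<close> are the two ends of the word, the
  odd one first: the arc between them is the outermost one.\<close>

lemma column_key_extremal:
  assumes "p \<in> {1..2 * k - 1}" "x \<in> {1..2 * k}"
  shows "x \<noteq> (if odd p then p else p + 1) \<Longrightarrow>
      column_key k p (if odd p then p else p + 1) < column_key k p x"
    and "x \<noteq> (if odd p then p + 1 else p) \<Longrightarrow>
      column_key k p x < column_key k p (if odd p then p + 1 else p)"
  using assms
  by (cases "odd p"; cases "x \<le> p"; cases "odd x"; simp add: column_key_def; linarith)+

text \<open>The two end columns of the word reveal its pivot.\<close>

lemma pivot_unique:
  assumes "p \<in> {1..2 * k - 1}" "q \<in> {1..2 * k - 1}"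
    and "\<And>x y. \<lbrakk>x \<in> {1..2 * k}; y \<in> {1..2 * k}\<rbrakk> \<Longrightarrow>
      column_key k p x < column_key k p y \<longleftrightarrow> column_key k q x < column_key k q y"
  shows "p = q"
proof -
  let ?first = "\<lambda>p. if odd p then p else p + 1" and ?last = "\<lambda>p. if odd p then p + 1 else p"
  have range: "?first p \<in> {1..2 * k}" "?first q \<in> {1..2 * k}"
    "?last p \<in> {1..2 * k}" "?last q \<in> {1..2 * k}"
    using assms(1,2) by auto
  have "?first p = ?first q"
    using column_key_extremal(1)[OF assms(1) range(2)] column_key_extremal(1)[OF assms(2) range(1)]
      assms(3)[OF range(1,2)] by (metis order_less_asym)
  moreover have "?last p = ?last q"
    using column_key_extremal(2)[OF assms(1) range(4)] column_key_extremal(2)[OF assms(2) range(3)]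
      assms(3)[OF range(4,3)] by (metis order_less_asym)
  ultimately show ?thesis
    by (auto split: if_splits)
qed

section \<open>The order of a single row\<close>

text \<open>Only steps within one parity class are assumed, so that the odd and the even columns of
  a row can be treated separately.\<close>

lemma step_two_mono:
  fixes h :: "nat \<Rightarrow> int"
  assumes "\<And>c. \<lbrakk>x \<le> c; c + 2 \<le> y; even (x + c)\<rbrakk> \<Longrightarrow> h c < h (c + 2)"
    and "x < y" and "even (x + y)"
  shows "h x < h y"
  using assms
proof (induction y rule: less_induct)
  case (less y)
  then have "x + 2 \<le> y"
    by presburger
  then obtain c where c: "y = c + 2" "x \<le> c"
    by (metis add.commute add_le_cancel_left le_Suc_ex trans_le_add1)
  have "h c < h y"
    using less.prems(1)[of c] less.prems(3) c by auto
  moreover have "x = c \<or> h x < h c"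
    using less.IH[of c] less.prems c by force
  ultimately show ?case
    by auto
qed

text \<open>At every vertex the spiral through four consecutive faces either expands, or contracts, or its
  two outer arcs lie side by side. After contracting it cannot expand again, so it changes its behaviour
  at one place only, and this is the pivot.\<close>

lemma row_pivot:
  fixes g :: "nat \<Rightarrow> int"
  assumes "k \<ge> 1"
    and inj: "\<And>x y. \<lbrakk>x \<in> {1..2 * k}; y \<in> {1..2 * k}; x \<noteq> y\<rbrakk> \<Longrightarrow> g x \<noteq> g y"
    and odd_arc: "\<And>i. \<lbrakk>odd i; i + 1 \<le> 2 * k\<rbrakk> \<Longrightarrow> g i < g (i + 1)"
    and even_arc: "\<And>i. \<lbrakk>even i; 1 \<le> i; i + 1 \<le> 2 * k\<rbrakk> \<Longrightarrow> g (i + 1) < g i"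
    and odd_nc: "\<And>i. \<lbrakk>odd i; i + 3 \<le> 2 * k\<rbrakk> \<Longrightarrow>
      \<not> (g i < g (i + 2) \<and> g (i + 2) < g (i + 1) \<and> g (i + 1) < g (i + 3)) \<and>
      \<not> (g (i + 2) < g i \<and> g i < g (i + 3) \<and> g (i + 3) < g (i + 1))"
    and even_nc: "\<And>i. \<lbrakk>even i; 1 \<le> i; i + 3 \<le> 2 * k\<rbrakk> \<Longrightarrow>
      \<not> (g (i + 1) < g (i + 3) \<and> g (i + 3) < g i \<and> g i < g (i + 2)) \<and>
      \<not> (g (i + 3) < g (i + 1) \<and> g (i + 1) < g (i + 2) \<and> g (i + 2) < g i)"
  obtains p where "p \<in> {1..2 * k - 1}"
    and "\<And>x y. \<lbrakk>x \<in> {1..2 * k}; y \<in> {1..2 * k}\<rbrakk> \<Longrightarrow>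
      g x < g y \<longleftrightarrow> column_key k p x < column_key k p y"
proof -
  \<comment> \<open>Expansion moves the next odd column up and the next even column down, hence
    outward in both cases.\<close>
  define expands where "expands c = (if odd c then g (c + 2) < g c else g c < g (c + 2))" for c
  \<comment> \<open>The first column at which expansion fails. The guard makes
    \<open>2 * k - 1\<close> a witness, so \<open>p\<close> exists even for a row that always
    expands.\<close>
  define p where "p = (LEAST c. 1 \<le> c \<and> (c + 2 \<le> 2 * k \<longrightarrow> \<not> expands c))"
  have witness: "1 \<le> 2 * k - 1 \<and> (2 * k - 1 + 2 \<le> 2 * k \<longrightarrow> \<not> expands (2 * k - 1))"
    using \<open>k \<ge> 1\<close> by auto
  have p: "1 \<le> p" "p \<le> 2 * k - 1" "p + 2 \<le> 2 * k \<longrightarrow> \<not> expands p"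
    using LeastI[where P = "\<lambda>c. 1 \<le> c \<and> (c + 2 \<le> 2 * k \<longrightarrow> \<not> expands c)", OF witness]
      Least_le[where P = "\<lambda>c. 1 \<le> c \<and> (c + 2 \<le> 2 * k \<longrightarrow> \<not> expands c)", OF witness]
    unfolding p_def by auto
  have expands: "expands c" if "1 \<le> c" "c < p" for c
    using not_less_Least[OF that(2)[unfolded p_def]] that(1) by blast
  have idx: "c + 2 + 1 = c + 3" "c + 1 + 1 = c + 2" "c + 1 + 2 = c + 3" for c :: nat
    by auto
  \<comment> \<open>The middle arc and contraction at \<open>c\<close> place column
    \<open>c + 2\<close> inside the arc from \<open>c\<close> to \<open>c + 1\<close>; noncrossing
    then places column \<open>c + 3\<close> inside it as well.\<close>
  have vertex: "\<not> expands (c + 1)" if "\<not> expands c" "1 \<le> c" "c + 3 \<le> 2 * k" for c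
  proof (cases "odd c")
    case True
    have "g c < g (c + 1)" "g (c + 2) < g (c + 3)" "g (c + 2) < g (c + 1)" "g c \<noteq> g (c + 2)"
      using that True odd_arc[of c] odd_arc[of "c + 2", unfolded idx] even_arc[of "c + 1", unfolded idx]
        inj[of c "c + 2"] by auto
    then show ?thesis
      using that True odd_nc[OF True that(3)] unfolding expands_def idx by auto
  next
    case False
    have "g (c + 1) < g c" "g (c + 3) < g (c + 2)" "g (c + 1) < g (c + 2)" "g c \<noteq> g (c + 2)"
      using that False even_arc[of c] even_arc[of "c + 2", unfolded idx] odd_arc[of "c + 1", unfolded idx]
        inj[of c "c + 2"] by auto
    then show ?thesis
      using that False even_nc[OF _ that(2,3)] unfolding expands_def idx by auto
  qed
  have contracts: "\<not> expands c" if "p \<le> c" "c + 2 \<le> 2 * k" for c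
    using that
  proof (induction c rule: dec_induct)
    case base
    then show ?case using p by auto
  next
    case (step c)
    then show ?case using \<open>1 \<le> p\<close> vertex[of c] by auto
  qed
  have left_odd: "g y < g x" if "odd x" "odd y" "x < y" "y \<le> p + 1" for x y
  proof -
    have "- g x < - g y"
    proof (rule step_two_mono)
      fix c assume c: "x \<le> c" "c + 2 \<le> y" "even (x + c)"
      then show "- g c < - g (c + 2)"
        using that odd_pos[of x] expands[of c] by (auto simp: expands_def)
    qed (use that in auto)
    then show ?thesis by simp
  qed
  have left_even: "g x < g y" if "even x" "even y" "1 \<le> x" "x < y" "y \<le> p + 1" for x y
  proof (rule step_two_mono)
    fix c assume c: "x \<le> c" "c + 2 \<le> y" "even (x + c)"
    then show "g c < g (c + 2)"
      using that expands[of c] by (auto simp: expands_def)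
  qed (use that in auto)
  have right_odd: "g x < g y" if "odd x" "odd y" "p \<le> x" "x < y" "y \<le> 2 * k" for x y
  proof (rule step_two_mono)
    fix c assume c: "x \<le> c" "c + 2 \<le> y" "even (x + c)"
    then show "g c < g (c + 2)"
      using that p(1) contracts[of c] inj[of c "c + 2"] by (auto simp: expands_def)
  qed (use that in auto)
  have right_even: "g y < g x" if "even x" "even y" "p \<le> x" "x < y" "y \<le> 2 * k" for x y
  proof -
    have "- g x < - g y"
    proof (rule step_two_mono)
      fix c assume c: "x \<le> c" "c + 2 \<le> y" "even (x + c)"
      then show "- g c < - g (c + 2)"
        using that p(1) contracts[of c] inj[of c "c + 2"] by (auto simp: expands_def)
    qed (use that in auto)
    then show ?thesis by simp
  qed
  \<comment> \<open>Columns \<open>1\<close> and \<open>2\<close> are the innermost pair of the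
    expanding spiral: all other odd columns lie above \<open>1\<close>, all other even ones below
    \<open>2\<close>.\<close>
  have left: "g x < g y" if "odd x" "even y" "1 \<le> y" "x \<le> p + 1" "y \<le> p + 1" for x y
  proof -
    have "x = 1 \<or> g x < g 1"
      using left_odd[of 1 x] that odd_pos[of x] by fastforce
    moreover have "y = 2 \<or> g 2 < g y"
      using left_even[of 2 y] that by (cases "y = 2"; auto; presburger)
    moreover have "g 1 < g 2"
      using odd_arc[of 1] \<open>k \<ge> 1\<close> by (simp add: numeral_2_eq_2)
    ultimately show ?thesis by auto
  qed
  \<comment> \<open>The mirror argument, anchored at the last columns \<open>2 * k - 1\<close> and
    \<open>2 * k\<close>.\<close>
  have right: "g x < g y" if "odd x" "even y" "p \<le> x" "p \<le> y" "x \<le> 2 * k" "y \<le> 2 * k" for x y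
  proof -
    have "x = 2 * k - 1 \<or> g x < g (2 * k - 1)"
      using right_odd[of x "2 * k - 1"] that \<open>k \<ge> 1\<close> by (cases "x < 2 * k - 1") (auto, presburger)
    moreover have "y = 2 * k \<or> g (2 * k) < g y"
      using right_even[of y "2 * k"] that by (cases "y < 2 * k") auto
    moreover have "g (2 * k - 1) < g (2 * k)"
      using odd_arc[of "2 * k - 1"] \<open>k \<ge> 1\<close> by simp
    ultimately show ?thesis by auto
  qed
  \<comment> \<open>Expansion at \<open>p - 1\<close> and contraction at \<open>p\<close> exclude
    nesting of the arcs from \<open>p - 1\<close> to \<open>p\<close> and from \<open>p + 1\<close>
    to \<open>p + 2\<close>, and crossing is forbidden; so they lie side by side.\<close>
  have middle: "if odd p then g (p - 1) < g (p + 2) else g (p + 2) < g (p - 1)"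
    if "2 \<le> p" "p + 2 \<le> 2 * k"
  proof -
    obtain c where c: "p = c + 1" "1 \<le> c"
      using \<open>2 \<le> p\<close> by (cases p) auto
    have bounds: "c + 3 \<le> 2 * k"
      using c that by simp
    have "expands c" "\<not> expands (c + 1)"
      using expands[of c] contracts[of "c + 1"] c that by auto
    then show ?thesis
      using c bounds odd_nc[of c] odd_arc[of c] odd_arc[of "c + 2", unfolded idx]
        even_arc[of "c + 1", unfolded idx] even_nc[of c] even_arc[of c]
        even_arc[of "c + 2", unfolded idx] odd_arc[of "c + 1", unfolded idx]
        inj[of "c + 1" "c + 3"] inj[of c "c + 3"]
      unfolding expands_def c(1) idx by (cases "odd c") auto
  qed
  have cross: "if odd p then g x < g y else g y < g x"
    if xy: "1 \<le> x" "x \<le> p" "p < y" "y \<le> 2 * k" for x y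
  proof -
    consider "x = p" | "y = p + 1" | "x < p" "p + 2 \<le> y"
      using xy by atomize_elim auto
    then show ?thesis
    proof cases
      case 1
      then show ?thesis
        using that right_odd[of p y] right[of p y] right_even[of p y] right[of y p] by auto
    next
      case 2
      then show ?thesis
        using that left_odd[of x y] left[of x y] left_even[of x y] left[of y x] by auto
    next
      \<comment> \<open>Apart from \<open>p\<close> and \<open>p + 1\<close>, the columns
        \<open>p - 1\<close> and \<open>p + 2\<close> are the faces of the two sides that are
        closest to the other side, so \<open>middle\<close> separates all of them.\<close>
      case 3
      then have bounds: "2 \<le> p" "p + 2 \<le> 2 * k"
        using that by auto
      show ?thesis
      proof (cases "odd p")
        case True
        have "x = p - 1 \<or> g x < g (p - 1)"
          using left[of x "p - 1"] left_even[of x "p - 1"] True 3 that by fastforce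
        moreover have "y = p + 2 \<or> g (p + 2) < g y"
          using right[of "p + 2" y] right_odd[of "p + 2" y] True 3 that by fastforce
        ultimately show ?thesis
          using middle[OF bounds] True by auto
      next
        case False
        have "x = p - 1 \<or> g (p - 1) < g x"
          using left[of "p - 1" x] left_odd[of x "p - 1"] False 3 that by fastforce
        moreover have "y = p + 2 \<or> g y < g (p + 2)"
          using right[of y "p + 2"] right_even[of "p + 2" y] False 3 that by fastforce
        ultimately show ?thesis
          using middle[OF bounds] False by auto
      qed
    qed
  qed
  have mono: "g x < g y"
    if "x \<in> {1..2 * k}" "y \<in> {1..2 * k}" "column_key k p x < column_key k p y" for x y
  proof -
    consider "x \<le> p" "y \<le> p" | "p < x" "p < y" | "x \<le> p" "p < y" | "p < x" "y \<le> p"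
      by atomize_elim auto
    then show ?thesis
    proof cases
      case 1
      then show ?thesis
        using that left_odd[of y x] left_even[of x y] left[of x y]
        by (cases "odd x"; cases "odd y") (auto simp: column_key_def)
    next
      case 2
      then show ?thesis
        using that right_odd[of x y] right_even[of y x] right[of x y]
        by (cases "odd x"; cases "odd y") (auto simp: column_key_def)
    next
      case 3
      then show ?thesis
        using that cross[of x y] by (cases "odd p"; cases "odd x"; cases "odd y") (auto simp: column_key_def)
    next
      case 4
      then show ?thesis
        using that cross[of y x] by (cases "odd p"; cases "odd x"; cases "odd y") (auto simp: column_key_def)
    qed
  qed
  \<comment> \<open>One implication suffices, since distinct columns have distinct keys.\<close>
  have "g x < g y \<longleftrightarrow> column_key k p x < column_key k p y"
    if "x \<in> {1..2 * k}" "y \<in> {1..2 * k}" for x y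
    using mono[of x y] mono[of y x] column_key_inj[of x k y p] that
    by (cases "column_key k p x" "column_key k p y" rule: linorder_cases) auto
  with p(1,2) show thesis
    by (intro that[of p]) auto
qed

section \<open>Comparing the two rows\<close>

lemma valid_key_hinge:
  assumes "valid_key k f" "c \<in> {1..2 * k}"
  shows "odd c \<Longrightarrow> f (A c) < f (B c)" and "even c \<Longrightarrow> f (B c) < f (A c)"
  using valid_keyD(4)[OF assms(1), of "H c"] assms(2) by auto

lemma valid_key_upper_arc:
  assumes "valid_key k f" "i \<in> {1..2 * k - 1}"
  shows "odd i \<Longrightarrow> f (A i) < f (A (i + 1))" and "even i \<Longrightarrow> f (A (i + 1)) < f (A i)"
  using valid_keyD(4)[OF assms(1), of "U i"] assms(2) by auto

lemma valid_key_lower_arc: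
  assumes "valid_key k f" "i \<in> {1..2 * k - 1}"
  shows "odd i \<Longrightarrow> f (B i) < f (B (i + 1))" and "even i \<Longrightarrow> f (B (i + 1)) < f (B i)"
  using valid_keyD(4)[OF assms(1), of "L i"] assms(2) by auto

lemma valid_key_hinge_nc:
  assumes "valid_key k f" "c \<in> {1..2 * k}" "d \<in> {1..2 * k}" "c \<noteq> d"
  shows "\<not> (f (upper_wing (H c)) < f (upper_wing (H d)) \<and>
    f (upper_wing (H d)) < f (lower_wing (H c)) \<and> f (lower_wing (H c)) < f (lower_wing (H d)))"
  using valid_keyD(5)[OF assms(1), of "H c" "H d"] assms(2-) by auto

text \<open>The right-hand side compares only faces of one row, which is why the rows determine the
  state. For equal parities the two hinges point the same way, and noncrossing makes them nested or
  disjoint as the rows prescribe. For opposite parities the hinges alone may leave open which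
  contains the other; comparing, in the upper row, the odd column with the left neighbour of the
  even one settles it.\<close>

lemma cross_rows:
  assumes f: "valid_key k f" and x: "x \<in> {1..2 * k}" and y: "y \<in> {1..2 * k}"
  shows "f (A x) < f (B y) \<longleftrightarrow>
    (if odd x then
       if odd y then x = y \<or> f (A x) < f (A y) \<or> f (B x) < f (B y)
       else f (B x) < f (B y) \<or> f (A x) < f (A (y - 1))
     else
       if odd y then f (A x) < f (A y) \<or> f (B x) < f (B y) \<and> f (A y) < f (A (x - 1))
       else x \<noteq> y \<and> \<not> f (A y) < f (A x) \<and> \<not> f (B y) < f (B x))"
proof -
  note H = valid_key_hinge[OF f x] valid_key_hinge[OF f y]
  note ncH = valid_key_hinge_nc[OF f x y] valid_key_hinge_nc[OF f y x]
  note neq = valid_keyD(1)[OF f x y] valid_keyD(2)[OF f x y] valid_keyD(3)[OF f x y]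
    valid_keyD(3)[OF f y x]
  have mixed: "f (A u) < f (B v) \<longleftrightarrow> f (B u) < f (B v) \<or> f (A u) < f (A (v - 1))"
    "f (A v) < f (B u) \<longleftrightarrow> f (A v) < f (A u) \<or> f (B v) < f (B u) \<and> f (A u) < f (A (v - 1))"
    if u: "u \<in> {1..2 * k}" "odd u" and v: "v \<in> {1..2 * k}" "even v" for u v
  proof -
    \<comment> \<open>The lower arc ending in \<open>B v\<close> is \<open>L w\<close>. As
      \<open>u\<close> and \<open>w\<close> are both odd, it has the target class of
      \<open>U u\<close>.\<close>
    obtain w where w: "v = w + 1" "odd w" "w \<in> {1..2 * k}" "w \<in> {1..2 * k - 1}"
      using v by (cases v) (auto dest: odd_pos)
    have u': "u \<in> {1..2 * k - 1}"
      using u by (cases "u = 2 * k") auto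
    have uv: "u \<noteq> v"
      using u v by auto
    have H: "f (A u) < f (B u)" "f (B v) < f (A v)" "f (A w) < f (B w)"
      using valid_key_hinge[OF f] u v w by auto
    have arcs: "f (A u) < f (A (u + 1))" "f (B u) < f (B (u + 1))" "f (A w) < f (A v)" "f (B w) < f (B v)"
      using valid_key_upper_arc[OF f] valid_key_lower_arc[OF f] u u' w by auto
    have nc_uv: "\<not> (f (A u) < f (B v) \<and> f (B v) < f (B u) \<and> f (B u) < f (A v))"
      "\<not> (f (B v) < f (A u) \<and> f (A u) < f (A v) \<and> f (A v) < f (B u))"
      using valid_key_hinge_nc[OF f u(1) v(1) uv] valid_key_hinge_nc[OF f v(1) u(1) uv[symmetric]]
        u v by auto
    have nc_uw: "\<not> (f (A u) < f (A w) \<and> f (A w) < f (B u) \<and> f (B u) < f (B w))"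
      "\<not> (f (A w) < f (A u) \<and> f (A u) < f (B w) \<and> f (B w) < f (B u))" if "u \<noteq> w"
      using valid_key_hinge_nc[OF f u(1) w(3)] valid_key_hinge_nc[OF f w(3) u(1)] u w that by auto
    have nc_arc: "\<not> (f (B w) < f (A u) \<and> f (A u) < f (B v) \<and> f (B v) < f (A (u + 1)))"
      using valid_keyD(5)[OF f, of "L w" "U u"] u u' w by auto
    have eq: "u + 1 = v" if "u = w"
      using w that by simp
    have ne: "f (A u) \<noteq> f (A v)" "f (B u) \<noteq> f (B v)" "f (A u) \<noteq> f (B v)" "f (A v) \<noteq> f (B u)"
      "u \<noteq> w \<Longrightarrow> f (A u) \<noteq> f (A w)" "u \<noteq> w \<Longrightarrow> f (B u) \<noteq> f (B w)"
      using valid_keyD(1-3)[OF f] u v w uv by auto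
    have "f (B (u + 1)) < f (A (u + 1))"
      using valid_key_hinge[OF f, of "u + 1"] u u' by auto
    then have nest: "f (B v) < f (A (u + 1))" if "f (B v) < f (B u)"
      using that arcs(2) by linarith
    \<comment> \<open>Otherwise \<open>A w\<close> lies above \<open>A u\<close>. Noncrossing of
      \<open>L w\<close> and \<open>U u\<close> then yields \<open>f (A u) < f (B w)\<close>, so
      that the hinges of \<open>w\<close> and \<open>u\<close> cross.\<close>
    have first: "f (A u) < f (A w)"
      if "f (A u) < f (B v)" "f (B v) < f (B u)"
    proof (rule ccontr)
      assume "\<not> f (A u) < f (A w)"
      moreover have "u \<noteq> w"
        using that arcs(4) by auto
      ultimately have "f (A w) < f (A u)" "f (A u) < f (B w)"
        using ne(5) valid_keyD(3)[OF f u(1) w(3)] nc_arc that nest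
        by auto
      then show False
        using nc_uw(2)[OF \<open>u \<noteq> w\<close>] arcs(4) that by auto
    qed
    have v_w: "v - 1 = w"
      using w by simp
    show fst: "f (A u) < f (B v) \<longleftrightarrow> f (B u) < f (B v) \<or> f (A u) < f (A (v - 1))"
      unfolding v_w using first H(1,3) arcs(4) ne(2) by linarith
    show "f (A v) < f (B u) \<longleftrightarrow> f (A v) < f (A u) \<or> f (B v) < f (B u) \<and> f (A u) < f (A (v - 1))"
      using fst H(1,2) nc_uv ne(1,3,4) by linarith
  qed
  show ?thesis
  proof (cases "odd x \<longleftrightarrow> odd y")
    case True
    then show ?thesis
      using H ncH neq by (cases "x = y"; cases "odd x"; simp; smt (verit))
  next
    case False
    then show ?thesis
      using mixed(1)[of x y] mixed(2)[of y x] x y by auto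
  qed
qed

text \<open>\<open>cross_rows\<close> transfers agreement within the rows to the comparisons between
  them.\<close>

lemma order_by_eqI:
  assumes f: "valid_key k f" and f': "valid_key k f'"
    and rows: "\<And>x y. \<lbrakk>x \<in> {1..2 * k}; y \<in> {1..2 * k}\<rbrakk> \<Longrightarrow>
      (f (A x) < f (A y) \<longleftrightarrow> f' (A x) < f' (A y)) \<and> (f (B x) < f (B y) \<longleftrightarrow> f' (B x) < f' (B y))"
  shows "order_by k f = order_by k f'"
proof -
  have AB: "f (A x) < f (B y) \<longleftrightarrow> f' (A x) < f' (B y)" if "x \<in> {1..2 * k}" "y \<in> {1..2 * k}" for x y
  proof -
    have "even z \<Longrightarrow> z \<in> {1..2 * k} \<Longrightarrow> z - 1 \<in> {1..2 * k}" for z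
      by (cases z) (auto dest: odd_pos)
    then show ?thesis
      unfolding cross_rows[OF f that] cross_rows[OF f' that] using rows that by simp
  qed
  have BA: "f (B y) < f (A x) \<longleftrightarrow> f' (B y) < f' (A x)" if "x \<in> {1..2 * k}" "y \<in> {1..2 * k}" for x y
    using AB[OF that] valid_keyD(3)[OF f that] valid_keyD(3)[OF f' that] by linarith
  have "f u < f v \<longleftrightarrow> f' u < f' v" if "u \<in> faces k" "v \<in> faces k" for u v
    using that rows AB BA by (cases u; cases v) auto
  then show ?thesis
    by (auto simp: order_by_def)
qed

section \<open>Compatibility of the two pivots\<close>

lemma rows_compatible:
  assumes f: "valid_key k f" and x: "x \<in> {1..2 * k}" "odd x" and y: "y \<in> {1..2 * k}" "even y"
    and "f (A y) < f (A x)"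
  shows "f (B y) < f (B x)"
  \<comment> \<open>The hinges extend the hypothesis to the chain
    \<open>f (B y) < f (A y) < f (A x) < f (B x)\<close>.\<close>
  using valid_key_hinge[OF f x(1)] valid_key_hinge[OF f y(1)] assms(2-)
    valid_keyD(2)[OF f x(1) y(1)] by fastforce

text \<open>Within one spiral every odd column precedes every even one, so an even column precedes
  an odd one only if the pivot separates them. If \<open>a\<close> is not extreme and differs from
  \<open>b\<close>, some pair is inverted for \<open>a\<close> but not for \<open>b\<close>.\<close>

lemma compatible_pivots:
  assumes a: "a \<in> {1..2 * k - 1}" and b: "b \<in> {1..2 * k - 1}"
    and compat: "\<And>x y. \<lbrakk>x \<in> {1..2 * k}; odd x; y \<in> {1..2 * k}; even y;
      column_key k a y < column_key k a x\<rbrakk> \<Longrightarrow> column_key k b y < column_key k b x"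
  shows "a = 1 \<or> a = 2 * k - 1 \<or> a = b"
proof (rule ccontr)
  assume contra: "\<not> ?thesis"
  show False
  proof (cases "odd a")
    case True
    then obtain s where s: "a = 2 * s + 1" by (elim oddE)
    have bounds: "3 \<le> a" "a + 3 \<le> 2 * k" "a - 1 \<ge> 2"
      using a contra s by (auto, presburger)
    \<comment> \<open>Columns \<open>2\<close> and \<open>2 * k - 1\<close> lie on opposite sides of
      \<open>a\<close>, which forces \<open>b\<close> to be odd and not extreme.\<close>
    have "column_key k b 2 < column_key k b (2 * k - 1)"
      using compat[of "2 * k - 1" 2] True bounds by (auto simp: column_key_def)
    then have "odd b" "2 \<le> b" "b < 2 * k - 1"
      using bounds b by (auto simp: column_key_def split: if_splits)
    show False
    proof (cases "a < b")
      case less: True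
      then have "a + 2 \<le> b"
        using True \<open>odd b\<close> by presburger
      then show False
        using compat[of "a + 2" 2] True bounds \<open>odd b\<close> b by (auto simp: column_key_def)
    next
      case False
      then have "b + 2 \<le> a"
        using True \<open>odd b\<close> contra by presburger
      moreover obtain j where "k = j + 1"
        using bounds by (cases k) auto
      ultimately show False
        using compat[of "2 * j + 1" "2 * s"] s bounds \<open>odd b\<close> b
        by (auto simp: column_key_def)
    qed
  next
    case False
    then have bounds: "2 \<le> a" "a + 2 \<le> 2 * k"
      using a contra by (auto elim!: evenE)
    \<comment> \<open>For an even pivot the right spiral comes first, and the columns
      \<open>2 * k\<close> and \<open>1\<close> force \<open>b\<close> to be even too.\<close>
    have "column_key k b (2 * k) < column_key k b 1"
      using compat[of 1 "2 * k"] False bounds by (auto simp: column_key_def)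
    then have "even b"
      using b by (auto simp: column_key_def split: if_splits)
    show False
    proof (cases "a < b")
      case True
      then show False
        using compat[of 1 b] False bounds \<open>even b\<close> b le_diff_conv2[of 1 "2 * k" b]
        by (auto simp: column_key_def)
    next
      case less: False
      then have "b + 2 \<le> a"
        using False \<open>even b\<close> contra by presburger
      then show False
        using compat[of "b + 1" "2 * k"] False bounds \<open>even b\<close> b by (auto simp: column_key_def)
    qed
  qed
qed

section \<open>Construction of the states\<close>

text \<open>Target classes reduce noncrossing to pairs of hinges and pairs of arcs with indices of
  equal parity, where the two arcs may lie in different rows.\<close>

lemma valid_keyI:
  assumes inj: "\<And>x y. \<lbrakk>x \<in> {1..2 * k}; y \<in> {1..2 * k}\<rbrakk> \<Longrightarrow>
      (x \<noteq> y \<longrightarrow> f (A x) \<noteq> f (A y) \<and> f (B x) \<noteq> f (B y)) \<and> f (A x) \<noteq> f (B y)"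
    and dir: "\<And>e. e \<in> creases k \<Longrightarrow> f (upper_wing e) < f (lower_wing e)"
    and H: "\<And>c d. \<lbrakk>c \<in> {1..2 * k}; d \<in> {1..2 * k}; c \<noteq> d\<rbrakk> \<Longrightarrow>
      \<not> (f (upper_wing (H c)) < f (upper_wing (H d)) \<and>
        f (upper_wing (H d)) < f (lower_wing (H c)) \<and> f (lower_wing (H c)) < f (lower_wing (H d)))"
    and arcs: "\<And>e e' i j. \<lbrakk>e \<in> {U i, L i}; e' \<in> {U j, L j}; e \<noteq> e'; i \<in> {1..2 * k - 1};
      j \<in> {1..2 * k - 1}; even (i + j)\<rbrakk> \<Longrightarrow>
      \<not> (f (upper_wing e) < f (upper_wing e') \<and>
        f (upper_wing e') < f (lower_wing e) \<and> f (lower_wing e) < f (lower_wing e'))"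
  shows "valid_key k f"
  unfolding valid_key_def
proof (intro conjI ballI impI)
  have "u = v" if "u \<in> faces k" "v \<in> faces k" "f u = f v" for u v
    using that inj by (cases u; cases v) (force+)
  then show "inj_on f (faces k)"
    by (rule inj_onI)
next
  fix e e' assume e: "e \<in> creases k" "e' \<in> creases k"
    "e \<noteq> e' \<and> target_class e = target_class e' \<and> wings e \<inter> wings e' = {}"
  then consider c d where "e = H c" "e' = H d"
    | i j where "e \<in> {U i, L i}" "e' \<in> {U j, L j}" "even (i + j)"
    by (cases e; cases e') (auto split: if_splits)
  then show "\<not> (f (upper_wing e) < f (upper_wing e') \<and>
      f (upper_wing e') < f (lower_wing e) \<and> f (lower_wing e) < f (lower_wing e'))"
  proof cases
    case 1
    then show ?thesis
      using H[of c d] e by fastforce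
  next
    case 2
    then have "i \<in> {1..2 * k - 1}" "j \<in> {1..2 * k - 1}"
      using e by auto
    then show ?thesis
      using arcs[OF 2(1,2) _ _ _ 2(3)] e by blast
  qed
qed (rule dir)

section \<open>Arcs of a column word and the two single spirals\<close>

lemma column_key_arc:
  assumes "p \<in> {1..2 * k - 1}" "i \<in> {1..2 * k - 1}"
  shows "odd i \<Longrightarrow> column_key k p i < column_key k p (i + 1)"
    and "even i \<Longrightarrow> column_key k p (i + 1) < column_key k p i"
  using assms by (cases "i = p"; auto simp: column_key_def)+

text \<open>Arcs of equal parity are nested on one side of the pivot and disjoint on different
  sides; the arc at the pivot encloses all others.\<close>

lemma column_key_arcs_nc:
  assumes "p \<in> {1..2 * k - 1}" "i \<in> {1..2 * k - 1}" "j \<in> {1..2 * k - 1}" "even (i + j)"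
  shows "odd i \<Longrightarrow> \<not> (column_key k p i < column_key k p j \<and>
      column_key k p j < column_key k p (i + 1) \<and> column_key k p (i + 1) < column_key k p (j + 1))"
    and "even i \<Longrightarrow> \<not> (column_key k p (i + 1) < column_key k p (j + 1) \<and>
      column_key k p (j + 1) < column_key k p i \<and> column_key k p i < column_key k p j)"
  using assms by (auto simp: column_key_def)

text \<open>The purely contracting spiral.\<close>

lemma column_key_first:
  assumes "x \<in> {1..2 * k}" "y \<in> {1..2 * k}"
  shows "column_key k 1 x < column_key k 1 y \<longleftrightarrow>
    (if odd x then even y \<or> x < y else even y \<and> y < x)"
  using assms by (cases "x = 1"; cases "y = 1"; cases "odd x"; cases "odd y") (auto simp: column_key_def)

text \<open>The purely expanding spiral. Only column \<open>2 * k\<close> lies beyond the pivot, and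
  its key is still the largest.\<close>

lemma column_key_last:
  assumes "x \<in> {1..2 * k}" "y \<in> {1..2 * k}"
  shows "column_key k (2 * k - 1) x < column_key k (2 * k - 1) y \<longleftrightarrow>
    (if odd x then even y \<or> y < x else even y \<and> x < y)"
proof -
  have "column_key k (2 * k - 1) c =
      (if c = 2 * k then 10 * int k else if odd c then - int c else int c)" if "c \<in> {1..2 * k}" for c
  proof -
    have "odd (2 * k - 1)" "c \<le> 2 * k - 1 \<longleftrightarrow> c \<noteq> 2 * k"
      using that by auto
    then show ?thesis
      unfolding column_key_def by (cases "c = 2 * k") simp_all
  qed
  with assms show ?thesis
    by auto
qed

text \<open>Each column becomes two adjacent slots ordered by its hinge, so both rows inherit the
  order of \<open>h\<close>.\<close>

fun doubled_key :: "(nat \<Rightarrow> int) \<Rightarrow> face \<Rightarrow> int" where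
  "doubled_key h (A c) = 2 * h c + (if odd c then 0 else 1)"
| "doubled_key h (B c) = 2 * h c + (if odd c then 1 else 0)"

text \<open>The base \<open>100 * int k\<close> exceeds in absolute value every
  \<open>doubled_key\<close> of a column word. With \<open>t\<close> the radius decreases from left
  to right, as in a contracting spiral; otherwise it increases, as in an expanding one.\<close>

definition outer_radius :: "nat \<Rightarrow> bool \<Rightarrow> nat \<Rightarrow> int" where
  "outer_radius k t c = 100 * int k + (if t then - int c else int c)"

text \<open>Every state arises from a column word by replacing each column by its two faces. If the upper row
  is a single spiral, the upper faces on the left (\<open>t\<close>) or on the right (\<open>\<not> t\<close>) of the pivot of the
  lower row are then moved outside of all other faces.\<close>

fun outer_key :: "nat \<Rightarrow> nat \<Rightarrow> bool \<Rightarrow> face \<Rightarrow> int" where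
  "outer_key k b t (A c) =
     (if c \<le> b \<longleftrightarrow> t then if odd c then - outer_radius k t c else outer_radius k t c
      else doubled_key (column_key k b) (A c))"
| "outer_key k b t (B c) = doubled_key (column_key k b) (B c)"

section \<open>States with equal row words\<close>

lemma doubled_key_less:
  assumes "x \<in> {1..2 * k}" "y \<in> {1..2 * k}" "x \<noteq> y" "u \<in> {A x, B x}" "v \<in> {A y, B y}"
  shows "doubled_key (column_key k p) u < doubled_key (column_key k p) v \<longleftrightarrow>
      column_key k p x < column_key k p y"
  using column_key_inj[OF assms(1,2), of p] assms(3-)
  by (cases "column_key k p x" "column_key k p y" rule: linorder_cases) (auto split: if_splits)

lemma doubled_key_bound:
  assumes "x \<in> {1..2 * k}"
  shows "- 50 * int k < doubled_key (column_key k p) (A x)"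
    and "doubled_key (column_key k p) (A x) < 50 * int k"
    and "- 50 * int k < doubled_key (column_key k p) (B x)"
    and "doubled_key (column_key k p) (B x) < 50 * int k"
  using assms by (auto simp: column_key_def)

text \<open>Hinges occupy adjacent slots and hence cross nothing; arcs with different indices
  inherit noncrossing from the column word.\<close>

lemma valid_doubled_key:
  assumes p: "p \<in> {1..2 * k - 1}"
  shows "valid_key k (doubled_key (column_key k p))"
proof (rule valid_keyI)
  fix x y assume "x \<in> {1..2 * k}" "y \<in> {1..2 * k}"
  then show "(x \<noteq> y \<longrightarrow> doubled_key (column_key k p) (A x) \<noteq> doubled_key (column_key k p) (A y) \<and>
      doubled_key (column_key k p) (B x) \<noteq> doubled_key (column_key k p) (B y)) \<and>
      doubled_key (column_key k p) (A x) \<noteq> doubled_key (column_key k p) (B y)"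
    using column_key_inj[of x k y p] by (cases "x = y"; auto; presburger)
next
  fix e assume "e \<in> creases k"
  then show "doubled_key (column_key k p) (upper_wing e) < doubled_key (column_key k p) (lower_wing e)"
    using column_key_arc[OF p] by (cases e) force+
next
  fix c d :: nat assume "c \<in> {1..2 * k}" "d \<in> {1..2 * k}" "c \<noteq> d"
  then show "\<not> (doubled_key (column_key k p) (upper_wing (H c)) < doubled_key (column_key k p) (upper_wing (H d)) \<and>
        doubled_key (column_key k p) (upper_wing (H d)) < doubled_key (column_key k p) (lower_wing (H c)) \<and>
        doubled_key (column_key k p) (lower_wing (H c)) < doubled_key (column_key k p) (lower_wing (H d)))"
    by auto
next
  fix e e' i j
  assume e: "e \<in> {U i, L i}" "e' \<in> {U j, L j}" "e \<noteq> e'" and i: "i \<in> {1..2 * k - 1}"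
    and j: "j \<in> {1..2 * k - 1}" and ij: "even (i + j)"
  show "\<not> (doubled_key (column_key k p) (upper_wing e) < doubled_key (column_key k p) (upper_wing e') \<and>
        doubled_key (column_key k p) (upper_wing e') < doubled_key (column_key k p) (lower_wing e) \<and>
        doubled_key (column_key k p) (lower_wing e) < doubled_key (column_key k p) (lower_wing e'))"
  proof (cases "i = j")
    \<comment> \<open>Here the arcs are \<open>U i\<close> and \<open>L i\<close>, and the lower one
      is nested inside the upper one.\<close>
    case True
    then show ?thesis
      using e by (cases "odd j") auto
  next
    case False
    have cols: "i \<in> {1..2 * k}" "i + 1 \<in> {1..2 * k}" "j \<in> {1..2 * k}" "j + 1 \<in> {1..2 * k}"
      using i j by auto
    have neq: "i + 1 \<noteq> j" "j + 1 \<noteq> i" "i + 1 \<noteq> j + 1"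
      using ij False by auto
    show ?thesis
    proof (cases "odd i")
      case True
      with ij have "odd j" by simp
      have w: "upper_wing e \<in> {A i, B i}" "lower_wing e \<in> {A (i + 1), B (i + 1)}"
        "upper_wing e' \<in> {A j, B j}" "lower_wing e' \<in> {A (j + 1), B (j + 1)}"
        using e True \<open>odd j\<close> by auto
      show ?thesis
        unfolding doubled_key_less[OF cols(1,3) False w(1,3)]
          doubled_key_less[OF cols(3,2) neq(1)[symmetric] w(3,2)]
          doubled_key_less[OF cols(2,4) neq(3) w(2,4)]
        by (rule column_key_arcs_nc(1)[OF p i j ij True])
    next
      case even: False
      with ij have "even j" by simp
      have w: "upper_wing e \<in> {A (i + 1), B (i + 1)}" "lower_wing e \<in> {A i, B i}"
        "upper_wing e' \<in> {A (j + 1), B (j + 1)}" "lower_wing e' \<in> {A j, B j}"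
        using e even \<open>even j\<close> by auto
      show ?thesis
        unfolding doubled_key_less[OF cols(2,4) neq(3) w(1,3)]
          doubled_key_less[OF cols(4,1) neq(2) w(3,2)]
          doubled_key_less[OF cols(1,3) False w(2,4)]
        using column_key_arcs_nc(2)[OF p i j ij] even by simp
    qed
  qed
qed

text \<open>The upper arc at the pivot joins the very first to the very last face. It is the only
  upper arc of which exactly one wing is moved later.\<close>

lemma doubled_key_extremal:
  assumes p: "p \<in> {1..2 * k - 1}" and v: "v \<in> faces k"
  shows "doubled_key (column_key k p) (upper_wing (U p)) \<le> doubled_key (column_key k p) v"
    and "doubled_key (column_key k p) v \<le> doubled_key (column_key k p) (lower_wing (U p))"
proof -
  obtain c where c: "c \<in> {1..2 * k}" "v \<in> {A c, B c}"
    using v by (cases v) auto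
  show "doubled_key (column_key k p) (upper_wing (U p)) \<le> doubled_key (column_key k p) v"
    using column_key_extremal(1)[OF p c(1)] c(2)
    by (cases "odd p"; cases "c = p"; cases "c = p + 1"; auto)
  show "doubled_key (column_key k p) v \<le> doubled_key (column_key k p) (lower_wing (U p))"
    using column_key_extremal(2)[OF p c(1)] c(2)
    by (cases "odd p"; cases "c = p"; cases "c = p + 1"; auto)
qed

section \<open>Moving the upper faces of one side outward\<close>

lemma outer_radius_bound:
  assumes "c \<in> {1..2 * k}"
  shows "50 * int k < outer_radius k t c"
  using assms by (auto simp: outer_radius_def)

text \<open>A moved wing lies outside all doubled positions. If only one wing is moved, the arc is
  the one at the pivot, and its other wing is already extremal.\<close>

lemma outer_arc_encloses:
  assumes b: "b \<in> {1..2 * k - 1}" and i: "i \<in> {1..2 * k - 1}"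
    and outer: "(i \<le> b \<longleftrightarrow> t) \<or> (i + 1 \<le> b \<longleftrightarrow> t)" and v: "v \<in> faces k"
  shows "outer_key k b t (upper_wing (U i)) \<le> doubled_key (column_key k b) v"
    and "doubled_key (column_key k b) v \<le> outer_key k b t (lower_wing (U i))"
proof -
  have bounds: "- 50 * int k < doubled_key (column_key k b) v" "doubled_key (column_key k b) v < 50 * int k"
    using doubled_key_bound v by (cases v; auto simp del: doubled_key.simps)+
  have radius: "50 * int k < outer_radius k t i" "50 * int k < outer_radius k t (i + 1)"
    using outer_radius_bound i by auto
  have "i = b" if "(i \<le> b) \<noteq> t \<or> (i + 1 \<le> b) \<noteq> t"
    using that outer by (cases t) auto
  then show "outer_key k b t (upper_wing (U i)) \<le> doubled_key (column_key k b) v"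
    "doubled_key (column_key k b) v \<le> outer_key k b t (lower_wing (U i))"
    using doubled_key_extremal[OF b v] bounds radius
    by (cases "(i \<le> b) = t"; cases "(i + 1 \<le> b) = t"; cases "odd i"; simp del: doubled_key.simps)+
qed

lemma outer_arcs_nested:
  assumes b: "b \<in> {1..2 * k - 1}" and ij: "i \<in> {1..2 * k - 1}" "j \<in> {1..2 * k - 1}"
    and parity: "even (i + j)" and neq: "i \<noteq> j"
    and outer_i: "(i \<le> b \<longleftrightarrow> t) \<or> (i + 1 \<le> b \<longleftrightarrow> t)"
    and outer_j: "(j \<le> b \<longleftrightarrow> t) \<or> (j + 1 \<le> b \<longleftrightarrow> t)"
    and order: "j < i \<longleftrightarrow> t"
  shows "outer_key k b t (upper_wing (U j)) \<le> outer_key k b t (upper_wing (U i))"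
    and "outer_key k b t (lower_wing (U i)) \<le> outer_key k b t (lower_wing (U j))"
proof -
  \<comment> \<open>The arc \<open>U j\<close> is farther from the pivot than \<open>U i\<close>, so
    both of its wings are moved.\<close>
  have j: "(j \<le> b) = t" "(j + 1 \<le> b) = t"
    using outer_i outer_j order neq parity by (cases t; auto)+
  have bounds: "- 50 * int k < doubled_key (column_key k b) (A c)"
    "doubled_key (column_key k b) (A c) < 50 * int k" if "c \<in> {1..2 * k}" for c
    using doubled_key_bound[OF that] by auto
  have faces: "i \<in> {1..2 * k}" "i + 1 \<in> {1..2 * k}" "j \<in> {1..2 * k}" "j + 1 \<in> {1..2 * k}"
    using ij by auto
  have radius: "outer_radius k t i < outer_radius k t j" "outer_radius k t (i + 1) < outer_radius k t (j + 1)"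
    using order neq by (auto simp: outer_radius_def)
  have "odd j \<longleftrightarrow> odd i"
    using parity by auto
  then show "outer_key k b t (upper_wing (U j)) \<le> outer_key k b t (upper_wing (U i))"
    "outer_key k b t (lower_wing (U i)) \<le> outer_key k b t (lower_wing (U j))"
    using j radius bounds[OF faces(1)] bounds[OF faces(2)]
      outer_radius_bound[OF faces(3), of t] outer_radius_bound[OF faces(4), of t]
    by (cases "(i \<le> b) = t"; cases "(i + 1 \<le> b) = t"; cases "odd i"; simp del: doubled_key.simps)+
qed

text \<open>An unmoved hinge occupies adjacent slots and cannot be crossed. The radii turn the
  spiral of the column word on the moved side inside out, so two moved hinges are nested for equal
  parity and disjoint otherwise.\<close>

lemma outer_hinges_nc:
  assumes b: "b \<in> {1..2 * k - 1}" and c: "c \<in> {1..2 * k}" and d: "d \<in> {1..2 * k}" and "c \<noteq> d"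
  shows "\<not> (outer_key k b t (upper_wing (H c)) < outer_key k b t (upper_wing (H d)) \<and>
        outer_key k b t (upper_wing (H d)) < outer_key k b t (lower_wing (H c)) \<and>
        outer_key k b t (lower_wing (H c)) < outer_key k b t (lower_wing (H d)))"
proof -
  note bounds = doubled_key_bound[OF c, of b] doubled_key_bound[OF d, of b]
    outer_radius_bound[OF c, of t] outer_radius_bound[OF d, of t]
  note less = doubled_key_less[OF c d \<open>c \<noteq> d\<close>] doubled_key_less[OF d c \<open>c \<noteq> d\<close>[symmetric]]
  have spiral: "column_key k b c < column_key k b d \<longleftrightarrow>
      (if odd c then even d \<or> outer_radius k t c < outer_radius k t d
       else even d \<and> outer_radius k t d < outer_radius k t c)"
    if "(c \<le> b) = t" "(d \<le> b) = t"
    using that c d by (cases t; cases "odd c"; cases "odd d")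
      (auto simp: column_key_def outer_radius_def)
  consider "(c \<le> b) \<noteq> t" "(d \<le> b) \<noteq> t" | "(c \<le> b) = t" "(d \<le> b) \<noteq> t"
    | "(c \<le> b) \<noteq> t" "(d \<le> b) = t" | "(c \<le> b) = t" "(d \<le> b) = t"
    by blast
  then show ?thesis
  proof cases
    case 1
    then have "outer_key k b t (upper_wing (H c)) = doubled_key (column_key k b) (upper_wing (H c))"
      "outer_key k b t (lower_wing (H c)) = doubled_key (column_key k b) (lower_wing (H c))"
      "outer_key k b t (upper_wing (H d)) = doubled_key (column_key k b) (upper_wing (H d))"
      "outer_key k b t (lower_wing (H d)) = doubled_key (column_key k b) (lower_wing (H d))"
      by (simp_all del: doubled_key.simps)
    moreover have "H c \<in> creases k" "H d \<in> creases k" "H c \<noteq> H d"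
      "target_class (H c) = target_class (H d)" "wings (H c) \<inter> wings (H d) = {}"
      using c d \<open>c \<noteq> d\<close> by auto
    ultimately show ?thesis
      using valid_keyD(5)[OF valid_doubled_key[OF b]] by presburger
  next
    case 2
    then show ?thesis
      using bounds less by (cases "odd c"; cases "odd d"; simp del: doubled_key.simps)
  next
    case 3
    then show ?thesis
      using bounds less by (cases "odd c"; cases "odd d"; simp del: doubled_key.simps)
  next
    case 4
    then show ?thesis
      using bounds less spiral by (cases "odd c"; cases "odd d"; simp del: doubled_key.simps)
  qed
qed

text \<open>Upper arcs with a moved wing are nested among themselves and enclose every other arc;
  the remaining arcs keep their positions from \<open>doubled_key\<close>.\<close>

lemma valid_outer_key:
  assumes b: "b \<in> {1..2 * k - 1}"
  shows "valid_key k (outer_key k b t)"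
proof (rule valid_keyI)
  fix x y assume xy: "x \<in> {1..2 * k}" "y \<in> {1..2 * k}"
  note bounds = doubled_key_bound[OF xy(1), of b] doubled_key_bound[OF xy(2), of b]
    outer_radius_bound[OF xy(1), of t] outer_radius_bound[OF xy(2), of t]
  note inj = valid_keyD(1-3)[OF valid_doubled_key[OF b] xy]
  have "outer_radius k t x \<noteq> outer_radius k t y" if "x \<noteq> y"
    using that by (simp add: outer_radius_def)
  then have "outer_key k b t (A x) \<noteq> outer_key k b t (A y)" if "x \<noteq> y"
    using that bounds(1,2,5,6,9,10) inj(1)[OF that]
    by (cases "(x \<le> b) = t"; cases "(y \<le> b) = t"; simp del: doubled_key.simps)
  moreover have "outer_key k b t (A x) \<noteq> outer_key k b t (B y)"
    using bounds inj(3) by (cases "(x \<le> b) = t"; cases "odd x") (simp_all del: doubled_key.simps)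
  ultimately show "(x \<noteq> y \<longrightarrow> outer_key k b t (A x) \<noteq> outer_key k b t (A y) \<and>
      outer_key k b t (B x) \<noteq> outer_key k b t (B y)) \<and>
      outer_key k b t (A x) \<noteq> outer_key k b t (B y)"
    using inj(2) by (simp del: doubled_key.simps)
next
  fix e assume e: "e \<in> creases k"
  note D = valid_keyD(4)[OF valid_doubled_key[OF b] e]
  show "outer_key k b t (upper_wing e) < outer_key k b t (lower_wing e)"
  proof (cases e)
    case (H c)
    then show ?thesis
      using e D doubled_key_bound[of c k b] outer_radius_bound[of c k t]
      by (cases "(c \<le> b) = t"; cases "odd c") (simp_all del: doubled_key.simps)
  next
    case (U i)
    then show ?thesis
      using e D outer_arc_encloses[OF b, of i t "upper_wing e"]
        outer_arc_encloses[OF b, of i t "lower_wing e"] wings_subset_faces[OF e]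
      by (cases "(i \<le> b) = t"; cases "(i + 1 \<le> b) = t"; cases "odd i") (simp_all del: doubled_key.simps)
  next
    case (L i)
    then show ?thesis
      using D by (cases "odd i") (simp_all del: doubled_key.simps)
  qed
next
  fix c d :: nat assume "c \<in> {1..2 * k}" "d \<in> {1..2 * k}" "c \<noteq> d"
  then show "\<not> (outer_key k b t (upper_wing (H c)) < outer_key k b t (upper_wing (H d)) \<and>
        outer_key k b t (upper_wing (H d)) < outer_key k b t (lower_wing (H c)) \<and>
        outer_key k b t (lower_wing (H c)) < outer_key k b t (lower_wing (H d)))"
    by (rule outer_hinges_nc[OF b])
next
  fix e e' i j
  assume e: "e \<in> {U i, L i}" "e' \<in> {U j, L j}" "e \<noteq> e'"
    and ij: "i \<in> {1..2 * k - 1}" "j \<in> {1..2 * k - 1}" "even (i + j)"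
  let ?outer = "\<lambda>i. (i \<le> b) = t \<or> (i + 1 \<le> b) = t"
  have e_creases: "e \<in> creases k" "e' \<in> creases k"
    using e ij by auto
  have inner: "outer_key k b t (upper_wing e) = doubled_key (column_key k b) (upper_wing e) \<and>
      outer_key k b t (lower_wing e) = doubled_key (column_key k b) (lower_wing e)"
    if "e = L i \<or> e = U i \<and> \<not> ?outer i" for e i
    using that by (auto simp del: doubled_key.simps)
  consider (both) "e = U i" "?outer i" "e' = U j" "?outer j"
    | (first) "e = U i" "?outer i" "e' = L j \<or> e' = U j \<and> \<not> ?outer j"
    | (second) "e = L i \<or> e = U i \<and> \<not> ?outer i" "e' = U j" "?outer j"
    | (none) "e = L i \<or> e = U i \<and> \<not> ?outer i" "e' = L j \<or> e' = U j \<and> \<not> ?outer j"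
    using e by blast
  then show "\<not> (outer_key k b t (upper_wing e) < outer_key k b t (upper_wing e') \<and>
        outer_key k b t (upper_wing e') < outer_key k b t (lower_wing e) \<and>
        outer_key k b t (lower_wing e) < outer_key k b t (lower_wing e'))"
  proof cases
    case both
    with e have "i \<noteq> j" by auto
    show ?thesis
    proof (cases "j < i \<longleftrightarrow> t")
      case True
      then show ?thesis
        using outer_arcs_nested(1)[OF b ij \<open>i \<noteq> j\<close> both(2,4)] unfolding both(1,3) by linarith
    next
      case False
      then have "i < j \<longleftrightarrow> t"
        using \<open>i \<noteq> j\<close> by auto
      then show ?thesis
        using outer_arcs_nested(2)[OF b ij(2,1) _ _ both(4,2)] ij(3) \<open>i \<noteq> j\<close>
        unfolding both(1,3) by (auto simp: add.commute)
    qed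
  next
    case first
    then show ?thesis
      using outer_arc_encloses(2)[OF b ij(1) first(2) wings_subset_faces(2)[OF e_creases(2)]]
        inner[OF first(3)] by auto
  next
    case second
    then show ?thesis
      using outer_arc_encloses(1)[OF b ij(2) second(3) wings_subset_faces(1)[OF e_creases(1)]]
        inner[OF second(1)] by auto
  next
    case none
    have "target_class e = target_class e'" "wings e \<inter> wings e' = {}"
      using e ij by auto
    then show ?thesis
      using valid_keyD(5)[OF valid_doubled_key[OF b] e_creases e(3)] inner[OF none(1)] inner[OF none(2)]
      by simp
  qed
qed

text \<open>Turning one side inside out makes the whole upper row contract (\<open>t\<close>) or
  expand (\<open>\<not> t\<close>), whatever the pivot \<open>b\<close> of the lower row.\<close>

lemma outer_key_less:
  assumes b: "b \<in> {1..2 * k - 1}" and x: "x \<in> {1..2 * k}" and y: "y \<in> {1..2 * k}"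
  shows "outer_key k b t (A x) < outer_key k b t (A y) \<longleftrightarrow>
    (if odd x then even y \<or> (if t then x < y else y < x)
     else even y \<and> (if t then y < x else x < y))" (is "_ \<longleftrightarrow> ?spiral")
proof -
  note bounds = doubled_key_bound(1,2)[OF x, of b] doubled_key_bound(1,2)[OF y, of b]
    outer_radius_bound[OF x, of t] outer_radius_bound[OF y, of t]
  have inner: "doubled_key (column_key k b) (A x) < doubled_key (column_key k b) (A y) \<longleftrightarrow> ?spiral"
    if "(x \<le> b) \<noteq> t" "(y \<le> b) \<noteq> t"
  proof (cases "x = y")
    case False
    have "column_key k b x < column_key k b y \<longleftrightarrow> ?spiral"
      using that x y by (cases t; cases "odd x"; cases "odd y") (auto simp: column_key_def)
    then show ?thesis
      using doubled_key_less[OF x y False] by blast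
  qed auto
  have radius: "outer_radius k t x < outer_radius k t y \<longleftrightarrow> (if t then y < x else x < y)"
    "outer_radius k t y < outer_radius k t x \<longleftrightarrow> (if t then x < y else y < x)"
    by (auto simp: outer_radius_def)
  consider "(x \<le> b) \<noteq> t" "(y \<le> b) \<noteq> t" | "(x \<le> b) = t" "(y \<le> b) = t"
    | "(x \<le> b) \<noteq> t" "(y \<le> b) = t" | "(x \<le> b) = t" "(y \<le> b) \<noteq> t"
    by blast
  then show ?thesis
  proof cases
    case 1
    then show ?thesis
      using inner by (simp del: doubled_key.simps)
  next
    case 2
    then show ?thesis
      using radius bounds(5,6) by (cases "odd x"; cases "odd y"; simp del: doubled_key.simps)
  next
    case 3
    \<comment> \<open>A moved and an unmoved column are separated by \<open>b\<close>, and
      \<open>t\<close> tells which is on the left.\<close>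
    then have "if t then y < x else x < y"
      by (cases t) auto
    then show ?thesis
      using 3 bounds by (cases "odd x"; cases "odd y"; cases t; simp del: doubled_key.simps)
  next
    case 4
    then have "if t then x < y else y < x"
      by (cases t) auto
    then show ?thesis
      using 4 bounds by (cases "odd x"; cases "odd y"; cases t; simp del: doubled_key.simps)
  qed
qed

section \<open>States and pairs of pivots\<close>

lemma has_row_orders_doubled_key:
  assumes "a \<in> {1..2 * k - 1}"
  shows "has_row_orders k (order_by k (doubled_key (column_key k a))) a a"
proof -
  have "(doubled_key (column_key k a) (A x) < doubled_key (column_key k a) (A y) \<longleftrightarrow>
        column_key k a x < column_key k a y) \<and>
      (doubled_key (column_key k a) (B x) < doubled_key (column_key k a) (B y) \<longleftrightarrow>
        column_key k a x < column_key k a y)"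
    if "x \<in> {1..2 * k}" "y \<in> {1..2 * k}" for x y
  proof (cases "x = y")
    case False
    then show ?thesis
      using doubled_key_less[OF that] by blast
  qed auto
  then show ?thesis
    by (simp add: has_row_orders_order_by[OF assms assms] del: doubled_key.simps)
qed

lemma has_row_orders_outer_key:
  assumes "b \<in> {1..2 * k - 1}"
  shows "has_row_orders k (order_by k (outer_key k b t)) (if t then 1 else 2 * k - 1) b"
proof -
  have "(if t then 1 else 2 * k - 1) \<in> {1..2 * k - 1}"
    using assms by auto
  moreover have "outer_key k b t (A x) < outer_key k b t (A y) \<longleftrightarrow>
      column_key k (if t then 1 else 2 * k - 1) x < column_key k (if t then 1 else 2 * k - 1) y"
    if "x \<in> {1..2 * k}" "y \<in> {1..2 * k}" for x y
    using outer_key_less[OF assms that, of t] column_key_first[OF that] column_key_last[OF that]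
    by (cases t) simp_all
  moreover have "outer_key k b t (B x) < outer_key k b t (B y) \<longleftrightarrow> column_key k b x < column_key k b y"
    if "x \<in> {1..2 * k}" "y \<in> {1..2 * k}" for x y
  proof (cases "x = y")
    case False
    then show ?thesis
      using doubled_key_less[OF that, of "B x" "B y" b] by simp
  qed auto
  ultimately show ?thesis
    using has_row_orders_order_by assms by blast
qed

text \<open>The parameters \<open>X\<close> and \<open>E\<close> let one application of
  \<open>row_pivot\<close> serve both rows.\<close>

lemma ex_pivot:
  assumes "k \<ge> 1" and f: "valid_key k f" and XE: "X = A \<and> E = U \<or> X = B \<and> E = L"
  obtains p where "p \<in> {1..2 * k - 1}"
    and "\<And>x y. \<lbrakk>x \<in> {1..2 * k}; y \<in> {1..2 * k}\<rbrakk> \<Longrightarrow>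
      f (X x) < f (X y) \<longleftrightarrow> column_key k p x < column_key k p y"
proof (rule row_pivot[where g = "\<lambda>c. f (X c)" and k = k])
  have wing: "upper_wing (E i) = (if odd i then X i else X (i + 1))"
    "lower_wing (E i) = (if odd i then X (i + 1) else X i)" for i
    using XE by auto
  have nc: "\<not> (f (upper_wing (E i)) < f (upper_wing (E j)) \<and> f (upper_wing (E j)) < f (lower_wing (E i)) \<and>
      f (lower_wing (E i)) < f (lower_wing (E j)))"
    if "i \<noteq> j" "even (i + j)" "i \<in> {1..2 * k - 1}" "j \<in> {1..2 * k - 1}" for i j
    using that XE by (intro valid_keyD(5)[OF f]) auto
  have next_col: "i + 2 + 1 = i + 3" for i :: nat
    by simp
  {
    fix i assume i: "odd i" "i + 3 \<le> 2 * k"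
    have i': "i \<in> {1..2 * k - 1}" "i + 2 \<in> {1..2 * k - 1}" "even (i + (i + 2))" "even (i + 2 + i)"
      using i odd_pos[OF i(1)] by auto
    show "\<not> (f (X i) < f (X (i + 2)) \<and> f (X (i + 2)) < f (X (i + 1)) \<and> f (X (i + 1)) < f (X (i + 3))) \<and>
      \<not> (f (X (i + 2)) < f (X i) \<and> f (X i) < f (X (i + 3)) \<and> f (X (i + 3)) < f (X (i + 1)))"
      using nc[OF _ i'(3,1,2)] nc[OF _ i'(4,2,1)] i(1) unfolding wing next_col by simp
  next
    fix i assume i: "even i" "1 \<le> i" "i + 3 \<le> 2 * k"
    have i': "i \<in> {1..2 * k - 1}" "i + 2 \<in> {1..2 * k - 1}" "even (i + (i + 2))" "even (i + 2 + i)"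
      using i by auto
    show "\<not> (f (X (i + 1)) < f (X (i + 3)) \<and> f (X (i + 3)) < f (X i) \<and> f (X i) < f (X (i + 2))) \<and>
      \<not> (f (X (i + 3)) < f (X (i + 1)) \<and> f (X (i + 1)) < f (X (i + 2)) \<and> f (X (i + 2)) < f (X i))"
      using nc[OF _ i'(3,1,2)] nc[OF _ i'(4,2,1)] i(1) unfolding wing next_col by simp
  next
    fix i assume "odd i" "i + 1 \<le> 2 * k"
    then show "f (X i) < f (X (i + 1))"
      using valid_key_upper_arc(1)[OF f, of i] valid_key_lower_arc(1)[OF f, of i] odd_pos[of i] XE
      by auto
  next
    fix i assume "even i" "1 \<le> i" "i + 1 \<le> 2 * k"
    then show "f (X (i + 1)) < f (X i)"
      using valid_key_upper_arc(2)[OF f, of i] valid_key_lower_arc(2)[OF f, of i] XE by auto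
  next
    fix x y assume "x \<in> {1..2 * k}" "y \<in> {1..2 * k}" "x \<noteq> y"
    then show "f (X x) \<noteq> f (X y)"
      using valid_keyD(1,2)[OF f] XE by blast
  }
qed (use \<open>k \<ge> 1\<close> that in auto)

lemma ex_row_pivots:
  assumes "k \<ge> 1" and "valid_key k f"
  obtains a b where "a \<in> {1..2 * k - 1}" "b \<in> {1..2 * k - 1}" "has_row_orders k (order_by k f) a b"
proof -
  obtain a where a: "a \<in> {1..2 * k - 1}" "\<And>x y. \<lbrakk>x \<in> {1..2 * k}; y \<in> {1..2 * k}\<rbrakk> \<Longrightarrow>
      f (A x) < f (A y) \<longleftrightarrow> column_key k a x < column_key k a y"
    using ex_pivot[OF assms, of A U] by blast
  obtain b where b: "b \<in> {1..2 * k - 1}" "\<And>x y. \<lbrakk>x \<in> {1..2 * k}; y \<in> {1..2 * k}\<rbrakk> \<Longrightarrow>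
      f (B x) < f (B y) \<longleftrightarrow> column_key k b x < column_key k b y"
    using ex_pivot[OF assms, of B L] by blast
  show thesis
    using that[OF a(1) b(1)] a b by (simp add: has_row_orders_order_by)
qed

lemma FullCompat_iff:
  assumes a: "a \<in> {1..2 * k - 1}" and b: "b \<in> {1..2 * k - 1}"
  shows "FullCompat k a b \<longleftrightarrow> a = 1 \<or> a = 2 * k - 1 \<or> a = b"
proof
  assume "FullCompat k a b"
  then obtain f where f: "valid_key k f" and rows: "has_row_orders k (order_by k f) a b"
    by (auto simp: FullCompat_def F_MMMMVV)
  show "a = 1 \<or> a = 2 * k - 1 \<or> a = b"
  proof (rule compatible_pivots[OF a b])
    fix x y assume "x \<in> {1..2 * k}" "odd x" "y \<in> {1..2 * k}" "even y"
      "column_key k a y < column_key k a x"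
    then show "column_key k b y < column_key k b x"
      using rows_compatible[OF f, of x y] rows unfolding has_row_orders_order_by[OF a b] by blast
  qed
next
  assume "a = 1 \<or> a = 2 * k - 1 \<or> a = b"
  \<comment> \<open>The case \<open>a = b\<close> is realised by \<open>doubled_key\<close>, the
    pivots \<open>1\<close> and \<open>2 * k - 1\<close> by \<open>outer_key\<close> with
    \<open>True\<close> and \<open>False\<close>.\<close>
  then show "FullCompat k a b"
    using has_row_orders_doubled_key[OF a] has_row_orders_outer_key[OF b, of True]
      has_row_orders_outer_key[OF b, of False] valid_doubled_key[OF a] valid_outer_key[OF b]
    unfolding FullCompat_def F_MMMMVV by auto
qed

lemma state_unique:
  assumes a: "a \<in> {1..2 * k - 1}" and b: "b \<in> {1..2 * k - 1}"
    and "r \<in> F MMMMVV k" "has_row_orders k r a b"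
    and "r' \<in> F MMMMVV k" "has_row_orders k r' a b"
  shows "r = r'"
proof -
  obtain f f' where f: "valid_key k f" "r = order_by k f" "valid_key k f'" "r' = order_by k f'"
    using assms(3,5) by (auto simp: F_MMMMVV)
  show ?thesis
    unfolding f(2,4)
  proof (rule order_by_eqI[OF f(1,3)])
    fix x y assume "x \<in> {1..2 * k}" "y \<in> {1..2 * k}"
    then show "(f (A x) < f (A y) \<longleftrightarrow> f' (A x) < f' (A y)) \<and> (f (B x) < f (B y) \<longleftrightarrow> f' (B x) < f' (B y))"
      using assms(4,6) unfolding f(2,4) has_row_orders_order_by[OF a b] by blast
  qed
qed

lemma pivots_unique:
  assumes ab: "a \<in> {1..2 * k - 1}" "b \<in> {1..2 * k - 1}"
    and ab': "a' \<in> {1..2 * k - 1}" "b' \<in> {1..2 * k - 1}"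
    and rows: "has_row_orders k r a b" "has_row_orders k r a' b'" and "r \<in> F MMMMVV k"
  shows "a = a'" and "b = b'"
proof -
  obtain f where "r = order_by k f"
    using \<open>r \<in> F MMMMVV k\<close> by (auto simp: F_MMMMVV)
  with rows show "a = a'" "b = b'"
    using pivot_unique[OF ab(1) ab'(1)] pivot_unique[OF ab(2) ab'(2)]
    by (simp_all only: has_row_orders_order_by[OF ab] has_row_orders_order_by[OF ab']) blast+
qed

theorem theorem7p1:
  fixes k m :: nat
  assumes "k \<ge> 2" and "m = 2 * k - 1"
  shows "(\<forall>a \<in> {1..m}. \<forall>b \<in> {1..m}. FullCompat k a b \<longleftrightarrow> a = 1 \<or> a = m \<or> a = b) \<and>
    (\<forall>a \<in> {1..m}. \<forall>b \<in> {1..m}. FullCompat k a b \<longrightarrow>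
       (\<exists>!r. r \<in> F MMMMVV k \<and> has_row_orders k r a b)) \<and>
    (\<forall>r \<in> F MMMMVV k. \<exists>!ab. ab \<in> {1..m} \<times> {1..m} \<and> has_row_orders k r (fst ab) (snd ab))"
proof (intro conjI ballI impI)
  fix a b assume "a \<in> {1..m}" "b \<in> {1..m}"
  then show "FullCompat k a b \<longleftrightarrow> a = 1 \<or> a = m \<or> a = b"
    using FullCompat_iff assms(2) by blast
next
  fix a b assume ab: "a \<in> {1..m}" "b \<in> {1..m}" and "FullCompat k a b"
  then obtain r where r: "r \<in> F MMMMVV k \<and> has_row_orders k r a b"
    by (auto simp: FullCompat_def)
  then show "\<exists>!r. r \<in> F MMMMVV k \<and> has_row_orders k r a b"
    using state_unique[OF ab[unfolded assms(2)]] by blast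
next
  fix r assume r: "r \<in> F MMMMVV k"
  then obtain f where "valid_key k f" "r = order_by k f"
    by (auto simp: F_MMMMVV)
  then obtain a b where ab: "a \<in> {1..m}" "b \<in> {1..m}" "has_row_orders k r a b"
    using ex_row_pivots[of k f] assms by auto
  show "\<exists>!ab. ab \<in> {1..m} \<times> {1..m} \<and> has_row_orders k r (fst ab) (snd ab)"
  proof (intro ex1I[of _ "(a, b)"])
    fix ab' assume ab': "ab' \<in> {1..m} \<times> {1..m} \<and> has_row_orders k r (fst ab') (snd ab')"
    then have "fst ab' \<in> {1..m}" "snd ab' \<in> {1..m}" "has_row_orders k r (fst ab') (snd ab')"
      by (simp_all add: mem_Times_iff)
    then show "ab' = (a, b)"
      using pivots_unique[OF _ _ _ _ _ ab(3) r] ab(1,2) unfolding assms(2) by (metis prod.collapse)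
  qed (use ab in auto)
qed

end
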